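(* Let $(M,g)$ and $(N,h)$ be Riemannian manifolds and let $u:(M,g)\to\mathbb{R}$ and $v:(N,h)\to\mathbb{R}$ be two infinity-harmonic functions. Then the map $\varphi:(M\times N,g+h)\to\mathbb{R}^2$ defined by $\varphi(x,y)=(u(x),v(y))$ for $(x,y)\in M\times N$ is an infinity-harmonic map.
   Context: A $C^2$ map $\psi:(M,g)\to(N,h)$ between Riemannian manifolds is infinity-harmonic if $\frac12\, d\psi(\mathrm{grad}\,|d\psi|^2)=0$, where $|d\psi|_x^2=\sum_i h(d\psi(e_i),d\psi(e_i))$ for an orthonormal basis $\{e_i\}$ of $T_xM$. An infinity-harmonic function is an infinity-harmonic map to $\mathbb{R}$, i.e. a $C^2$ function $u$ with $\frac12 g(\mathrm{grad}\,u,\mathrm{grad}\,|\mathrm{grad}\,u|^2)=0$. Here $g+h$ is the product metric and $\mathbb{R}^2$ has the Euclidean metric. *)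

theory Defs
  imports "HOL-Analysis.Analysis"
begin

section \<open>Maps of class \<open>C\<^sup>k\<close> between Euclidean spaces\<close>

text \<open>
  Intended for open \<open>S\<close>.  In finite dimension, continuity of all iterated directional
  derivatives is the same as continuity of the iterated Frechet derivative.
\<close>

primrec Ck_on :: "nat \<Rightarrow> 'a::euclidean_space set \<Rightarrow> ('a \<Rightarrow> 'b::euclidean_space) \<Rightarrow> bool" where
  "Ck_on 0 S f \<longleftrightarrow> continuous_on S f"
| "Ck_on (Suc k) S f \<longleftrightarrow>
     (\<forall>x\<in>S. f differentiable at x) \<and>
     (\<forall>v. Ck_on k S (\<lambda>x. frechet_derivative f (at x) v))"

definition smooth_on :: "'a::euclidean_space set \<Rightarrow> ('a \<Rightarrow> 'b::euclidean_space) \<Rightarrow> bool" where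
  "smooth_on S f \<longleftrightarrow> (\<forall>k. Ck_on k S f)"


section \<open>Smooth manifolds\<close>

text \<open>
  A chart is a pair \<open>(U, \<phi>)\<close>; only the values of \<open>\<phi>\<close> on \<open>U\<close> matter.
\<close>

type_synonym ('m, 'e) chart = "'m set \<times> ('m \<Rightarrow> 'e)"

record ('m, 'e) manifold =
  top_of :: "'m topology"
  atlas :: "('m, 'e) chart set"

abbreviation points :: "('m, 'e, 'z) manifold_scheme \<Rightarrow> 'm set" where
  "points M \<equiv> topspace (top_of M)"

definition chart_inv :: "('m, 'e) chart \<Rightarrow> 'e \<Rightarrow> 'm" where
  "chart_inv c = inv_into (fst c) (snd c)"

definition transition :: "('m, 'e) chart \<Rightarrow> ('m, 'e) chart \<Rightarrow> 'e \<Rightarrow> 'e" where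
  "transition c d = snd d \<circ> chart_inv c"

definition charts_at :: "('m, 'e, 'z) manifold_scheme \<Rightarrow> 'm \<Rightarrow> ('m, 'e) chart set" where
  "charts_at M x = {c \<in> atlas M. x \<in> fst c}"

definition smooth_manifold :: "('m, 'e::euclidean_space, 'z) manifold_scheme \<Rightarrow> bool" where
  "smooth_manifold M \<longleftrightarrow>
     Hausdorff_space (top_of M) \<and> second_countable (top_of M) \<and>
     (\<Union>c\<in>atlas M. fst c) = points M \<and>
     (\<forall>c\<in>atlas M. openin (top_of M) (fst c) \<and> open (snd c ` fst c) \<and>
        homeomorphic_map (subtopology (top_of M) (fst c)) (top_of_set (snd c ` fst c)) (snd c)) \<and>
     (\<forall>c\<in>atlas M. \<forall>d\<in>atlas M. smooth_on (snd c ` (fst c \<inter> fst d)) (transition c d))"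

definition Ck_map ::
  "nat \<Rightarrow> ('m, 'e::euclidean_space, 'z) manifold_scheme \<Rightarrow>
   ('n, 'f::euclidean_space, 'w) manifold_scheme \<Rightarrow> ('m \<Rightarrow> 'n) \<Rightarrow> bool" where
  "Ck_map k M N \<psi> \<longleftrightarrow>
     continuous_map (top_of M) (top_of N) \<psi> \<and>
     (\<forall>c\<in>atlas M. \<forall>d\<in>atlas N.
        Ck_on k (snd c ` (fst c \<inter> \<psi> -` fst d)) (snd d \<circ> \<psi> \<circ> chart_inv c))"


section \<open>Tangent vectors and differentials\<close>

text \<open>
  A tangent vector at \<open>x\<close> is a family of component vectors, one for each chart around \<open>x\<close>,
  that transforms by the derivatives of the transition maps.  The family is zero on charts
  not containing \<open>x\<close>, so that equality of tangent vectors is equality of functions and the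
  vector space operations are pointwise.
\<close>

type_synonym ('m, 'e) tvec = "('m, 'e) chart \<Rightarrow> 'e"

definition tangent_space ::
  "('m, 'e::euclidean_space, 'z) manifold_scheme \<Rightarrow> 'm \<Rightarrow> ('m, 'e) tvec set" where
  "tangent_space M x =
     {X. (\<forall>c\<in>charts_at M x. \<forall>d\<in>charts_at M x.
            X d = frechet_derivative (transition c d) (at (snd c x)) (X c)) \<and>
         (\<forall>c. c \<notin> charts_at M x \<longrightarrow> X c = 0)}"

text \<open>The tangent vector at \<open>x\<close> whose component vector in the chart \<open>c\<close> is \<open>a\<close>.\<close>

definition coord_vec ::
  "('m, 'e::euclidean_space, 'z) manifold_scheme \<Rightarrow> ('m, 'e) chart \<Rightarrow> 'm \<Rightarrow> 'e \<Rightarrow> ('m, 'e) tvec"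
where
  "coord_vec M c x a =
     (\<lambda>d. if d \<in> charts_at M x
          then frechet_derivative (transition c d) (at (snd c x)) a else 0)"

text \<open>
  \<open>differential M N \<psi> x\<close> is the linear map from the tangent space at \<open>x\<close> to the tangent
  space at \<open>\<psi> x\<close>.  By the chain rule it does not depend on the chart chosen around \<open>x\<close>.
\<close>

definition differential ::
  "('m, 'e::euclidean_space, 'z) manifold_scheme \<Rightarrow>
   ('n, 'f::euclidean_space, 'w) manifold_scheme \<Rightarrow> ('m \<Rightarrow> 'n) \<Rightarrow> 'm \<Rightarrow>
   ('m, 'e) tvec \<Rightarrow> ('n, 'f) tvec" where
  "differential M N \<psi> x X =
     (let c = (SOME c. c \<in> charts_at M x) in
      (\<lambda>d. if d \<in> charts_at N (\<psi> x)
           then frechet_derivative (snd d \<circ> \<psi> \<circ> chart_inv c) (at (snd c x)) (X c) else 0))"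


section \<open>Riemannian manifolds\<close>

record ('m, 'e) riemannian = "('m, 'e) manifold" +
  metric :: "'m \<Rightarrow> ('m, 'e) tvec \<Rightarrow> ('m, 'e) tvec \<Rightarrow> real"

definition riemannian_manifold :: "('m, 'e::euclidean_space) riemannian \<Rightarrow> bool" where
  "riemannian_manifold M \<longleftrightarrow>
     smooth_manifold M \<and>
     (\<forall>x\<in>points M. \<forall>X\<in>tangent_space M x. \<forall>Y\<in>tangent_space M x.
        metric M x X Y = metric M x Y X) \<and>
     (\<forall>x\<in>points M. \<forall>X\<in>tangent_space M x. \<forall>Y\<in>tangent_space M x. \<forall>Z\<in>tangent_space M x.
        \<forall>a b. metric M x (\<lambda>c. a *\<^sub>R X c + b *\<^sub>R Y c) Z = a * metric M x X Z + b * metric M x Y Z) \<and>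
     (\<forall>x\<in>points M. \<forall>X\<in>tangent_space M x. X \<noteq> (\<lambda>c. 0) \<longrightarrow> metric M x X X > 0) \<and>
     (\<forall>c\<in>atlas M. \<forall>a b. smooth_on (snd c ` fst c)
        (\<lambda>p. let x = chart_inv c p in metric M x (coord_vec M c x a) (coord_vec M c x b)))"

text \<open>A Euclidean space with its global chart and the standard metric.\<close>

abbreviation id_chart :: "('e, 'e) chart" where
  "id_chart \<equiv> (UNIV, \<lambda>x. x)"

definition euclidean_riemannian :: "('e::euclidean_space, 'e) riemannian" where
  "euclidean_riemannian =
     \<lparr> top_of = euclidean, atlas = {id_chart}, metric = (\<lambda>x X Y. X id_chart \<bullet> Y id_chart) \<rparr>"

definition prod_manifold ::
  "('m, 'e::euclidean_space, 'z) manifold_scheme \<Rightarrow>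
   ('n, 'f::euclidean_space, 'w) manifold_scheme \<Rightarrow> ('m \<times> 'n, 'e \<times> 'f) manifold" where
  "prod_manifold M N =
     \<lparr> top_of = prod_topology (top_of M) (top_of N),
       atlas = {(fst c \<times> fst d, map_prod (snd c) (snd d)) |c d. c \<in> atlas M \<and> d \<in> atlas N} \<rparr>"

text \<open>
  The product metric is the sum of the pullbacks of the two metrics along the projections.
\<close>

definition prod_riemannian ::
  "('m, 'e::euclidean_space) riemannian \<Rightarrow> ('n, 'f::euclidean_space) riemannian \<Rightarrow>
   ('m \<times> 'n, 'e \<times> 'f) riemannian" where
  "prod_riemannian M N =
     (let P = prod_manifold M N in
      \<lparr> top_of = top_of P, atlas = atlas P,
        metric = (\<lambda>p X Y.
          metric M (fst p) (differential P M fst p X) (differential P M fst p Y) +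
          metric N (snd p) (differential P N snd p X) (differential P N snd p Y)) \<rparr>)"


section \<open>Infinity-harmonic maps\<close>

definition orthonormal_basis ::
  "('m, 'e::euclidean_space) riemannian \<Rightarrow> 'm \<Rightarrow> ('m, 'e) tvec set \<Rightarrow> bool" where
  "orthonormal_basis M x B \<longleftrightarrow>
     finite B \<and> B \<subseteq> tangent_space M x \<and>
     (\<forall>X\<in>B. \<forall>Y\<in>B. metric M x X Y = (if X = Y then 1 else 0)) \<and>
     (\<forall>X\<in>tangent_space M x. \<exists>a. X = (\<lambda>c. \<Sum>E\<in>B. a E *\<^sub>R E c))"

text \<open>\<open>|d\<psi>|\<^sup>2\<close>; the sum does not depend on the orthonormal basis chosen.\<close>

definition norm_differential_sq ::
  "('m, 'e::euclidean_space) riemannian \<Rightarrow> ('n, 'f::euclidean_space) riemannian \<Rightarrow>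
   ('m \<Rightarrow> 'n) \<Rightarrow> 'm \<Rightarrow> real" where
  "norm_differential_sq M N \<psi> x =
     (\<Sum>E\<in>(SOME B. orthonormal_basis M x B).
        metric N (\<psi> x) (differential M N \<psi> x E) (differential M N \<psi> x E))"

text \<open>
  The differential of a real function at \<open>Y\<close>, read off in the global chart of the real line,
  is the directional derivative along \<open>Y\<close>.
\<close>

definition grad ::
  "('m, 'e::euclidean_space) riemannian \<Rightarrow> ('m \<Rightarrow> real) \<Rightarrow> 'm \<Rightarrow> ('m, 'e) tvec" where
  "grad M f x =
     (THE X. X \<in> tangent_space M x \<and>
        (\<forall>Y\<in>tangent_space M x.
           metric M x X Y = differential M euclidean_riemannian f x Y id_chart))"

definition infinity_harmonic_map ::
  "('m, 'e::euclidean_space) riemannian \<Rightarrow> ('n, 'f::euclidean_space) riemannian \<Rightarrow>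
   ('m \<Rightarrow> 'n) \<Rightarrow> bool" where
  "infinity_harmonic_map M N \<psi> \<longleftrightarrow>
     Ck_map 2 M N \<psi> \<and>
     (\<forall>x\<in>points M.
        (\<lambda>d. (1/2) *\<^sub>R differential M N \<psi> x (grad M (norm_differential_sq M N \<psi>) x) d) = (\<lambda>d. 0))"

definition infinity_harmonic_function ::
  "('m, 'e::euclidean_space) riemannian \<Rightarrow> ('m \<Rightarrow> real) \<Rightarrow> bool" where
  "infinity_harmonic_function M u \<longleftrightarrow> infinity_harmonic_map M euclidean_riemannian u"

end

theory Submission
  imports Defs
begin

text \<open>
  The energy density of \<open>\<phi> = (u, v)\<close> splits: \<open>|d\<phi>|\<^sup>2 (x, y) = |du|\<^sup>2 (x) + |dv|\<^sup>2 (y)\<close>.  Since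
  the product metric is an orthogonal sum, the gradient of this function is the pair of the
  gradients of \<open>|du|\<^sup>2\<close> and \<open>|dv|\<^sup>2\<close>, and \<open>d\<phi>\<close> maps it to the pair of
  \<open>du (grad |du|\<^sup>2)\<close> and \<open>dv (grad |dv|\<^sup>2)\<close>, which vanishes by hypothesis.

  The computation is done in a chart, where the metric at a point becomes a positive definite
  form on the model space.  Linear forms are represented by vectors (\<open>pos_def_form_riesz\<close>), and
  Parseval's identity for an orthonormal basis turns \<open>|du|\<^sup>2\<close> into the squared length of the
  vector representing \<open>du\<close> (\<open>norm_differential_sq_real\<close>); in particular the basis is
  irrelevant.  For the pair \<open>(u, v)\<close> the same identity is applied to the two components, whose
  representing vectors are tangent to the two factors.

  The gradient of \<open>|du|\<^sup>2\<close> is determined by a derivative, so this function has to be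
  differentiable in charts.  For \<open>C\<^sup>2\<close> functions this is \<open>norm_differential_sq_differentiable\<close>,
  a consequence of \<open>dual_norm_differentiable\<close>: the squared dual norm of a linear form that depends
  differentiably on a point, for an inner product that does so too, is differentiable.
\<close>

section \<open>Positive definite symmetric bilinear forms\<close>

text \<open>
  Symmetric bilinear positive definite forms; by symmetry, linearity in the second argument is enough.
\<close>

definition pos_def_form :: "('a::real_vector \<Rightarrow> 'a \<Rightarrow> real) \<Rightarrow> bool" where
  "pos_def_form B \<longleftrightarrow>
     (\<forall>a b. B a b = B b a) \<and> (\<forall>a. linear (B a)) \<and> (\<forall>a. a \<noteq> 0 \<longrightarrow> B a a > 0)"

text \<open>
  An orthonormal basis of the whole space for the form \<open>B\<close>, as an unordered finite set.
\<close>

definition orthonormal_frame :: "('a::real_vector \<Rightarrow> 'a \<Rightarrow> real) \<Rightarrow> 'a set \<Rightarrow> bool" where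
  "orthonormal_frame B F \<longleftrightarrow>
     finite F \<and> (\<forall>a\<in>F. \<forall>b\<in>F. B a b = (if a = b then 1 else 0)) \<and> span F = UNIV"

lemma pos_def_form_sym: "pos_def_form B \<Longrightarrow> B a b = B b a"
  by (auto simp: pos_def_form_def)

lemma pos_def_form_linear: "pos_def_form B \<Longrightarrow> linear (B a)"
  by (auto simp: pos_def_form_def)

lemma pos_def_form_linear_left: "pos_def_form B \<Longrightarrow> linear (\<lambda>a. B a b)"
  using pos_def_form_linear[of B b] by (simp add: pos_def_form_sym[of B _ b])

lemma pos_def_form_sum_left:
  "pos_def_form B \<Longrightarrow> B (\<Sum>i\<in>I. r i *\<^sub>R a i) b = (\<Sum>i\<in>I. r i * B (a i) b)"
  using linear_sum[OF pos_def_form_linear_left[of B b], of "\<lambda>i. r i *\<^sub>R a i" I]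
    linear_scale[OF pos_def_form_linear_left[of B b]] by simp

lemma pos_def_form_sum_right:
  "pos_def_form B \<Longrightarrow> B b (\<Sum>i\<in>I. r i *\<^sub>R a i) = (\<Sum>i\<in>I. r i * B b (a i))"
  using linear_sum[OF pos_def_form_linear[of B b], of "\<lambda>i. r i *\<^sub>R a i" I]
    linear_scale[OF pos_def_form_linear[of B b]] by simp

lemma pos_def_form_diff_left: "pos_def_form B \<Longrightarrow> B (a - b) c = B a c - B b c"
  using linear_diff[OF pos_def_form_linear_left[of B c]] by simp

lemma pos_def_form_diff_right: "pos_def_form B \<Longrightarrow> B c (a - b) = B c a - B c b"
  using linear_diff[OF pos_def_form_linear[of B c]] by simp

lemma pos_def_form_zero: "pos_def_form B \<Longrightarrow> B 0 a = 0" "pos_def_form B \<Longrightarrow> B a 0 = 0"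
  using linear_0[OF pos_def_form_linear[of B a]] by (simp_all add: pos_def_form_sym[of B 0 a])

lemma pos_def_form_nonneg: "pos_def_form B \<Longrightarrow> B a a \<ge> 0"
  by (cases "a = 0") (auto simp: pos_def_form_zero pos_def_form_def less_imp_le)

lemma pos_def_form_eqI:
  assumes "pos_def_form B" "\<And>b. B g b = B h b"
  shows "g = h"
proof (rule ccontr)
  assume "g \<noteq> h"
  then have "B (g - h) (g - h) > 0"
    using assms(1) by (auto simp: pos_def_form_def)
  then show False
    using assms by (simp add: pos_def_form_diff_left)
qed

lemma pos_def_form_frame_expansion:
  assumes B: "pos_def_form B" and F: "orthonormal_frame B F"
  shows "a = (\<Sum>f\<in>F. B a f *\<^sub>R f)"
proof -
  have fin: "finite F" and on: "\<And>a b. a \<in> F \<Longrightarrow> b \<in> F \<Longrightarrow> B a b = (if a = b then 1 else 0)"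
    using F by (auto simp: orthonormal_frame_def)
  have "a \<in> range (\<lambda>r. \<Sum>v\<in>F. r v *\<^sub>R v)"
    using F span_finite[OF fin] by (auto simp: orthonormal_frame_def)
  then obtain r where r: "a = (\<Sum>v\<in>F. r v *\<^sub>R v)" by auto
  have "B a f = r f" if "f \<in> F" for f
  proof -
    have "B a f = (\<Sum>v\<in>F. r v * B v f)"
      unfolding r by (rule pos_def_form_sum_left[OF B])
    also have "\<dots> = (\<Sum>v\<in>F. if v = f then r v else 0)"
      using on that by (intro sum.cong) auto
    finally show ?thesis using fin that by simp
  qed
  then show ?thesis using r by simp
qed

lemma pos_def_form_parseval:
  assumes B: "pos_def_form B" and F: "orthonormal_frame B F"
  shows "B a a = (\<Sum>f\<in>F. (B a f)\<^sup>2)"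
proof -
  have "B a a = B (\<Sum>f\<in>F. B a f *\<^sub>R f) a"
    by (rule arg_cong[OF pos_def_form_frame_expansion[OF assms], of "\<lambda>c. B c a"])
  also have "\<dots> = (\<Sum>f\<in>F. B a f * B f a)"
    by (rule pos_def_form_sum_left[OF B])
  also have "\<dots> = (\<Sum>f\<in>F. (B a f)\<^sup>2)"
    using pos_def_form_sym[OF B] by (intro sum.cong) (auto simp: power2_eq_square)
  finally show ?thesis .
qed

lemma orthonormal_frame_exists:
  fixes B :: "'a::euclidean_space \<Rightarrow> 'a \<Rightarrow> real"
  assumes B: "pos_def_form B"
  shows "\<exists>F. orthonormal_frame B F"
proof -
  define P where
    "P F \<longleftrightarrow> finite F \<and> (\<forall>a\<in>F. \<forall>b\<in>F. B a b = (if a = b then 1 else 0))" for F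
  have bound: "card F \<le> DIM('a)" if "P F" for F
  proof -
    have fin: "finite F" using that by (simp add: P_def)
    have coeff: "r f = 0" if r: "(\<Sum>v\<in>F. r v *\<^sub>R v) = 0" and f: "f \<in> F" for r f
    proof -
      have "0 = B (\<Sum>v\<in>F. r v *\<^sub>R v) f"
        unfolding r by (simp add: pos_def_form_zero[OF B])
      also have "\<dots> = (\<Sum>v\<in>F. r v * B v f)"
        by (rule pos_def_form_sum_left[OF B])
      also have "\<dots> = (\<Sum>v\<in>F. if v = f then r v else 0)"
        using \<open>P F\<close> f by (intro sum.cong) (auto simp: P_def)
      finally show ?thesis using fin f by simp
    qed
    have "independent F"
    proof
      assume "dependent F"
      then obtain r f where "f \<in> F" "r f \<noteq> 0" "(\<Sum>v\<in>F. r v *\<^sub>R v) = 0"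
        using dependent_finite[OF fin] by auto
      then show False using coeff[of r f] by simp
    qed
    then show ?thesis using independent_bound by blast
  qed
  have "P {}" by (simp add: P_def)
  moreover have "\<forall>F. P F \<longrightarrow> card F < Suc DIM('a)" using bound by (simp add: less_Suc_eq_le)
  ultimately have "\<exists>F. P F \<and> (\<forall>G. P G \<longrightarrow> card G \<le> card F)"
    by (rule ex_has_greatest_nat[of P "{}" card])
  then obtain F where F: "P F" and max: "\<And>G. P G \<Longrightarrow> card G \<le> card F"
    by blast
  have fin: "finite F" using F by (simp add: P_def)
  have "a \<in> span F" for a
  proof (rule ccontr)
    assume a: "a \<notin> span F"
    \<comment> \<open>The normalised component of \<open>a\<close> orthogonal to \<open>F\<close> would extend \<open>F\<close>.\<close>
    define z where "z = a - (\<Sum>f\<in>F. B a f *\<^sub>R f)"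
    have proj: "(\<Sum>f\<in>F. B a f *\<^sub>R f) \<in> span F"
      by (intro span_sum span_scale span_base)
    have "z \<noteq> 0"
    proof
      assume "z = 0"
      then have "a = (\<Sum>f\<in>F. B a f *\<^sub>R f)"
        unfolding z_def by (rule eq_iff_diff_eq_0[THEN iffD2])
      then have "a \<in> span F" by (rule ssubst) (rule proj)
      then show False using a by blast
    qed
    then have pos: "B z z > 0" using B by (simp add: pos_def_form_def)
    have z0: "B z f = 0" if f: "f \<in> F" for f
    proof -
      have "B (\<Sum>v\<in>F. B a v *\<^sub>R v) f = (\<Sum>v\<in>F. B a v * B v f)"
        by (rule pos_def_form_sum_left[OF B])
      also have "\<dots> = (\<Sum>v\<in>F. if v = f then B a v else 0)"
        using F f by (intro sum.cong) (auto simp: P_def)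
      finally show ?thesis
        using fin f by (simp add: z_def pos_def_form_diff_left[OF B])
    qed
    define e where "e = (1 / sqrt (B z z)) *\<^sub>R z"
    have eB: "B e c = B z c / sqrt (B z z)" for c
      using linear_scale[OF pos_def_form_linear_left[OF B, of c], of "1 / sqrt (B z z)" z]
      by (simp add: e_def)
    have ef: "B e f = 0" if "f \<in> F" for f
      by (simp add: eB z0[OF that])
    have ee: "B e e = 1"
    proof -
      have "B e e = B e z / sqrt (B z z)"
        unfolding eB[of e] by (simp only: pos_def_form_sym[OF B, of z e])
      also have "\<dots> = B z z / (sqrt (B z z) * sqrt (B z z))"
        unfolding eB[of z] by simp
      also have "\<dots> = 1"
        using pos by simp
      finally show ?thesis .
    qed
    have "e \<notin> F" using ef[of e] ee by auto
    moreover have "P (insert e F)"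
    proof -
      have "B f e = 0" if "f \<in> F" for f
        using ef[OF that] pos_def_form_sym[OF B, of f e] by simp
      then show ?thesis
        using F ee ef \<open>e \<notin> F\<close> unfolding P_def by (intro conjI ballI) auto
    qed
    ultimately show False
      using max[of "insert e F"] fin by simp
  qed
  then have "span F = UNIV" by blast
  with F have "orthonormal_frame B F"
    unfolding orthonormal_frame_def P_def by (intro conjI) blast+
  then show ?thesis by blast
qed

lemma pos_def_form_riesz:
  fixes B :: "'a::euclidean_space \<Rightarrow> 'a \<Rightarrow> real"
  assumes B: "pos_def_form B" and L: "linear L"
  shows "\<exists>g. \<forall>b. B g b = L b"
proof -
  obtain F where F: "orthonormal_frame B F"
    using orthonormal_frame_exists[OF B] by blast
  have "B (\<Sum>f\<in>F. L f *\<^sub>R f) b = L b" for b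
  proof -
    have "L b = L (\<Sum>f\<in>F. B b f *\<^sub>R f)"
      by (rule arg_cong[OF pos_def_form_frame_expansion[OF B F]])
    also have "\<dots> = (\<Sum>f\<in>F. B b f * L f)"
      by (simp add: linear_sum[OF L] linear_scale[OF L])
    finally show ?thesis
      by (simp add: pos_def_form_sum_left[OF B] pos_def_form_sym[OF B, of b] mult.commute)
  qed
  then show ?thesis by blast
qed

lemma pos_def_form_prod:
  assumes "pos_def_form B" "pos_def_form C"
  shows "pos_def_form (\<lambda>a b. B (fst a) (fst b) + C (snd a) (snd b))"
  unfolding pos_def_form_def
proof (intro conjI allI impI)
  fix a b
  show "B (fst a) (fst b) + C (snd a) (snd b) = B (fst b) (fst a) + C (snd b) (snd a)"
    by (simp only: pos_def_form_sym[OF assms(1), of "fst a" "fst b"]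
        pos_def_form_sym[OF assms(2), of "snd a" "snd b"])
  show "linear (\<lambda>b. B (fst a) (fst b) + C (snd a) (snd b))"
    using linear_compose_add[OF
        linear_compose[OF linear_fst pos_def_form_linear[OF assms(1), of "fst a"]]
        linear_compose[OF linear_snd pos_def_form_linear[OF assms(2), of "snd a"]]]
    by (simp add: o_def)
  assume "a \<noteq> 0"
  then have "fst a \<noteq> 0 \<or> snd a \<noteq> 0" by (metis prod.collapse zero_prod_def)
  then show "B (fst a) (fst a) + C (snd a) (snd a) > 0"
    using assms pos_def_form_nonneg[OF assms(1), of "fst a"]
      pos_def_form_nonneg[OF assms(2), of "snd a"]
    by (auto simp: pos_def_form_def intro: add_pos_nonneg add_nonneg_pos)
qed

section \<open>Differentiability of the dual norm\<close>

lemma pos_def_form_Basis: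
  fixes B :: "'a::euclidean_space \<Rightarrow> 'a \<Rightarrow> real"
  assumes B: "pos_def_form B"
  shows "B z w = (\<Sum>i\<in>Basis. \<Sum>j\<in>Basis. (z \<bullet> i) * (w \<bullet> j) * B i j)"
proof -
  have "B z w = B (\<Sum>i\<in>Basis. (z \<bullet> i) *\<^sub>R i) w" by (simp add: euclidean_representation)
  also have "\<dots> = (\<Sum>i\<in>Basis. (z \<bullet> i) * B i w)"
    by (rule pos_def_form_sum_left[OF B])
  also have "\<dots> = (\<Sum>i\<in>Basis. \<Sum>j\<in>Basis. (z \<bullet> i) * (w \<bullet> j) * B i j)"
  proof (intro sum.cong refl)
    fix i :: 'a
    have "B i w = B i (\<Sum>j\<in>Basis. (w \<bullet> j) *\<^sub>R j)" by (simp add: euclidean_representation)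
    also have "\<dots> = (\<Sum>j\<in>Basis. (w \<bullet> j) * B i j)"
      by (rule pos_def_form_sum_right[OF B])
    finally show "(z \<bullet> i) * B i w = (\<Sum>j\<in>Basis. (z \<bullet> i) * (w \<bullet> j) * B i j)"
      by (simp add: sum_distrib_left mult.assoc)
  qed
  finally show ?thesis .
qed

lemma pos_def_form_coercive:
  fixes B :: "'a::euclidean_space \<Rightarrow> 'a \<Rightarrow> real"
  assumes B: "pos_def_form B"
  shows "\<exists>m>0. \<forall>z. B z z \<ge> m * (norm z)\<^sup>2"
proof -
  have cont: "continuous_on (sphere 0 1) (\<lambda>z. B z z)"
  proof (rule continuous_on_eq)
    show "continuous_on (sphere 0 1) (\<lambda>z. \<Sum>i\<in>Basis. \<Sum>j\<in>Basis. (z \<bullet> i) * (z \<bullet> j) * B i j)"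
      by (intro continuous_intros)
  qed (rule pos_def_form_Basis[OF B, symmetric])
  have "sphere (0::'a) 1 \<noteq> {}" by simp
  then obtain s where s: "s \<in> sphere 0 1" and min: "\<And>z. z \<in> sphere 0 1 \<Longrightarrow> B s s \<le> B z z"
    using continuous_attains_inf[OF compact_sphere _ cont] by blast
  have "s \<noteq> 0" using s by auto
  then have "B s s > 0" using B by (simp add: pos_def_form_def)
  moreover have "B z z \<ge> B s s * (norm z)\<^sup>2" for z
  proof (cases "z = 0")
    case False
    define t where "t = (1 / norm z) *\<^sub>R z"
    have z: "z = norm z *\<^sub>R t" using False by (simp add: t_def)
    have "B s s \<le> B t t" using False by (intro min) (simp add: t_def)
    moreover have "B z z = (norm z)\<^sup>2 * B t t"
      by (subst (1 2) z) (simp add: linear_scale[OF pos_def_form_linear_left[OF B]]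
        linear_scale[OF pos_def_form_linear[OF B]] power2_eq_square)
    ultimately show ?thesis by (simp add: mult.commute[of "(norm z)\<^sup>2"] mult_right_mono
      del: mult_le_cancel_right)
  qed (simp add: pos_def_form_zero[OF B])
  ultimately show ?thesis by blast
qed

text \<open>
  If \<open>X p\<close> represents \<open>U p\<close> with respect to \<open>B p\<close>, then \<open>B p (X p) (X p)\<close> is the maximum over \<open>a\<close>
  of \<open>2 U p a - B p a a\<close>.  Differentiability at \<open>q\<close> follows as in the envelope theorem, without
  inverting the Gram matrix: the function \<open>l\<close> obtained by fixing the maximiser \<open>a = X q\<close> is
  differentiable at \<open>q\<close>, and the error \<open>f p - l p = B p (X p - X q) (X p - X q)\<close> is of second order.
\<close>

lemma dual_norm_differentiable:
  fixes B :: "'a::euclidean_space \<Rightarrow> 'a \<Rightarrow> 'a \<Rightarrow> real" and U :: "'a \<Rightarrow> 'a \<Rightarrow> real"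
  assumes S: "open S" "q \<in> S"
    and B: "\<And>p. p \<in> S \<Longrightarrow> pos_def_form (B p)"
    and dB: "\<And>a b. (\<lambda>p. B p a b) differentiable at q"
    and dU: "\<And>a. (\<lambda>p. U p a) differentiable at q"
    and f: "\<And>p. p \<in> S \<Longrightarrow> \<exists>X. (\<forall>b. B p X b = U p b) \<and> f p = B p X X"
  shows "f differentiable at q"
proof -
  obtain X where X: "\<And>p b. p \<in> S \<Longrightarrow> B p (X p) b = U p b"
    and fX: "\<And>p. p \<in> S \<Longrightarrow> f p = B p (X p) (X p)"
    using f by metis
  define l where "l p = 2 * U p (X q) - B p (X q) (X q)" for p
  define R where "R p b = U p b - B p (X q) b" for p b
  obtain m where m: "m > 0" and coer: "\<And>z. B q z z \<ge> m * (norm z)\<^sup>2"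
    using pos_def_form_coercive[OF B[OF S(2)]] by blast
  define D where "D p = (\<Sum>i\<in>Basis. \<Sum>j\<in>Basis. \<bar>B p i j - B q i j\<bar>)" for p
  have contB: "isCont (\<lambda>p. B p a b) q" for a b
    using dB differentiable_imp_continuous_within by blast
  have "isCont D q"
    unfolding D_def by (intro continuous_intros contB)
  moreover have "D q = 0" by (simp add: D_def)
  ultimately have "D \<midarrow>q\<rightarrow> 0" by (simp add: isCont_def)
  then have evD: "\<forall>\<^sub>F p in at q. D p < m / 2"
    by (rule order_tendstoD) (use m in simp)
  have evS: "\<forall>\<^sub>F p in at q. p \<in> S"
    using S eventually_at_topological by blast
  have dR: "(\<lambda>p. R p b) differentiable at q" for b
    unfolding R_def by (intro differentiable_diff dU dB)
  have R0: "R q b = 0" for b using X[OF S(2)] by (simp add: R_def)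
  have "\<exists>K. \<forall>\<^sub>F p in at q. \<bar>R p b\<bar> \<le> K * norm (p - q)" for b
  proof -
    obtain R' where R': "((\<lambda>p. R p b) has_derivative R') (at q)"
      using dR unfolding differentiable_def by blast
    obtain K where K: "\<And>h. norm (R' h) \<le> norm h * K"
      using bounded_linear.bounded[OF has_derivative_bounded_linear[OF R']] by blast
    obtain d where "d > 0"
      and d: "\<And>p. norm (p - q) < d \<Longrightarrow> norm (R p b - R q b - R' (p - q)) \<le> 1 * norm (p - q)"
      using R' unfolding has_derivative_at_alt by (meson zero_less_one)
    have "\<forall>\<^sub>F p in at q. dist p q < d"
      using \<open>d > 0\<close> by (auto simp: eventually_at)
    then have "\<forall>\<^sub>F p in at q. \<bar>R p b\<bar> \<le> (K + 1) * norm (p - q)"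
    proof eventually_elim
      case (elim p)
      then show ?case
        using d[of p] K[of "p - q"] R0[of b] by (simp add: dist_norm algebra_simps)
    qed
    then show ?thesis by blast
  qed
  then obtain K where K: "\<And>b. \<forall>\<^sub>F p in at q. \<bar>R p b\<bar> \<le> K b * norm (p - q)" by metis
  define C where "C = (\<Sum>i\<in>Basis. K i)"
  have evR: "\<forall>\<^sub>F p in at q. \<forall>i\<in>Basis. \<bar>R p i\<bar> \<le> K i * norm (p - q)"
    using K by (simp add: eventually_ball_finite_distrib)
  \<comment> \<open>\<open>R p\<close> is represented by \<open>X p - X q\<close> and is of first order at \<open>q\<close>, while \<open>B p\<close> is uniformly coercive near \<open>q\<close>.\<close>
  have key: "\<forall>\<^sub>F p in at q. \<bar>f p - l p\<bar> \<le> 2 * C\<^sup>2 / m * (norm (p - q))\<^sup>2"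
    using evS evD evR
  proof eventually_elim
    case (elim p)
    define z where "z = X p - X q"
    note Bp = B[OF elim(1)]
    have Rz: "B p z b = R p b" for b
      by (simp add: z_def R_def pos_def_form_diff_left[OF Bp] X[OF elim(1)])
    have fl: "f p - l p = B p z z"
    proof -
      have "U p (X q) = B p (X p) (X q)" using X[OF elim(1)] by simp
      then show ?thesis
        using pos_def_form_sym[OF Bp, of "X p" "X q"]
        by (simp add: fX[OF elim(1)] l_def z_def pos_def_form_diff_left[OF Bp]
          pos_def_form_diff_right[OF Bp])
    qed
    have "\<bar>B p z z - B q z z\<bar> = \<bar>\<Sum>i\<in>Basis. \<Sum>j\<in>Basis. (z \<bullet> i) * (z \<bullet> j) * (B p i j - B q i j)\<bar>"
      by (simp add: pos_def_form_Basis[OF Bp, of z z]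
        pos_def_form_Basis[OF B[OF S(2)], of z z] right_diff_distrib sum_subtractf)
    also have "\<dots> \<le> (\<Sum>i\<in>Basis. \<Sum>j\<in>Basis. \<bar>(z \<bullet> i) * (z \<bullet> j) * (B p i j - B q i j)\<bar>)"
      by (intro order.trans[OF sum_abs] sum_mono) auto
    also have "\<dots> \<le> (\<Sum>i\<in>Basis. \<Sum>j\<in>Basis. (norm z)\<^sup>2 * \<bar>B p i j - B q i j\<bar>)"
    proof (intro sum_mono)
      fix i j :: 'a assume "i \<in> Basis" "j \<in> Basis"
      then have "\<bar>z \<bullet> i\<bar> * \<bar>z \<bullet> j\<bar> \<le> norm z * norm z"
        by (intro mult_mono Basis_le_norm) auto
      then show "\<bar>(z \<bullet> i) * (z \<bullet> j) * (B p i j - B q i j)\<bar> \<le> (norm z)\<^sup>2 * \<bar>B p i j - B q i j\<bar>"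
        by (simp add: abs_mult power2_eq_square mult_right_mono)
    qed
    also have "\<dots> = (norm z)\<^sup>2 * D p"
      by (simp add: D_def sum_distrib_left)
    also have "\<dots> \<le> (norm z)\<^sup>2 * (m / 2)"
      using elim(2) by (intro mult_left_mono) auto
    finally have "\<bar>B p z z - B q z z\<bar> \<le> m * (norm z)\<^sup>2 / 2"
      by (simp add: mult.commute)
    then have low: "m * (norm z)\<^sup>2 / 2 \<le> B p z z"
      using coer[of z] by (simp only: abs_le_iff) linarith
    have "B p z z = (\<Sum>i\<in>Basis. (z \<bullet> i) * B p i z)"
      using pos_def_form_sum_left[OF Bp, of "\<lambda>i. z \<bullet> i" "\<lambda>i. i" Basis z]
      by (simp add: euclidean_representation)
    also have "\<dots> = (\<Sum>i\<in>Basis. (z \<bullet> i) * R p i)"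
      by (simp add: Rz pos_def_form_sym[OF Bp, of _ z])
    also have "\<dots> \<le> (\<Sum>i\<in>Basis. norm z * (K i * norm (p - q)))"
    proof (intro sum_mono)
      fix i :: 'a assume i: "i \<in> Basis"
      have "(z \<bullet> i) * R p i \<le> \<bar>z \<bullet> i\<bar> * \<bar>R p i\<bar>"
        by (simp flip: abs_mult)
      also have "\<dots> \<le> norm z * (K i * norm (p - q))"
        using i elim(3) by (intro mult_mono Basis_le_norm) auto
      finally show "(z \<bullet> i) * R p i \<le> norm z * (K i * norm (p - q))" .
    qed
    also have "\<dots> = C * norm (p - q) * norm z"
      by (simp add: C_def sum_distrib_left sum_distrib_right mult_ac)
    finally have up: "B p z z \<le> C * norm (p - q) * norm z" .
    define s where "s = C * norm (p - q)"
    have "(m * norm z - 2 * s) * norm z \<le> 0"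
      using order.trans[OF low up] by (simp add: s_def algebra_simps power2_eq_square)
    have "B p z z \<le> 2 * C\<^sup>2 / m * (norm (p - q))\<^sup>2"
    proof (cases "z = 0")
      case True
      then show ?thesis using m by (simp add: pos_def_form_zero[OF Bp])
    next
      case False
      then have "m * norm z \<le> 2 * s"
        using \<open>(m * norm z - 2 * s) * norm z \<le> 0\<close> by (simp add: mult_le_0_iff)
      then have n: "norm z \<le> 2 * s / m" using m by (simp add: field_simps)
      moreover have "s \<ge> 0"
      proof -
        have "0 \<le> m * norm z" using m by simp
        then show ?thesis using \<open>m * norm z \<le> 2 * s\<close> by linarith
      qed
      ultimately have "s * norm z \<le> s * (2 * s / m)" by (intro mult_left_mono)
      then show ?thesis using up by (simp add: s_def power2_eq_square algebra_simps)
    qed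
    then show ?case
      using pos_def_form_nonneg[OF Bp, of z] by (simp add: fl)
  qed
  have "l differentiable at q"
    unfolding l_def by (intro derivative_intros dU dB)
  then obtain l' where l': "(l has_derivative l') (at q)"
    unfolding differentiable_def by blast
  have fl_q: "f q - l q = 0"
    using X[OF S(2)] by (simp add: fX[OF S(2)] l_def)
  have "((\<lambda>p. f p - l p) has_derivative (\<lambda>h. 0)) (at q)"
    unfolding has_derivative_at
  proof (intro conjI bounded_linear_zero)
    define c where "c = 2 * C\<^sup>2 / m"
    have "((\<lambda>p. \<bar>f p - l p\<bar> / norm (p - q)) \<longlongrightarrow> 0) (at q)"
    proof (rule Lim_null_comparison)
      show "\<forall>\<^sub>F p in at q. norm (\<bar>f p - l p\<bar> / norm (p - q)) \<le> c * norm (p - q)"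
        using key
      proof eventually_elim
        case (elim p)
        then show ?case
          using m by (cases "p = q") (auto simp: c_def power2_eq_square field_simps)
      qed
      show "((\<lambda>p. c * norm (p - q)) \<longlongrightarrow> 0) (at q)"
        by (rule tendsto_eq_intros refl | simp)+
    qed
    then show "((\<lambda>h. norm (f (q + h) - l (q + h) - (f q - l q) - 0) / norm h) \<longlongrightarrow> 0) (at 0)"
      using LIM_offset_zero[of "\<lambda>p. \<bar>f p - l p\<bar> / norm (p - q)" 0 q] fl_q by simp
  qed
  from has_derivative_add[OF this l'] show ?thesis
    unfolding differentiable_def by auto
qed

section \<open>Coordinates on the tangent spaces\<close>

text \<open>
  The part of the definition of a smooth manifold that the calculus of tangent vectors uses:
  injective charts that cover the manifold, and differentiable transition maps on open sets.
  Unlike full smoothness, it passes to products with little effort.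
\<close>

definition differentiable_atlas :: "('m, 'e::euclidean_space, 'z) manifold_scheme \<Rightarrow> bool" where
  "differentiable_atlas M \<longleftrightarrow>
     (\<Union>c\<in>atlas M. fst c) = points M \<and>
     (\<forall>c\<in>atlas M. inj_on (snd c) (fst c)) \<and>
     (\<forall>c\<in>atlas M. \<forall>d\<in>atlas M. open (snd c ` (fst c \<inter> fst d)) \<and>
        (\<forall>p\<in>snd c ` (fst c \<inter> fst d). transition c d differentiable at p))"

lemma smooth_manifold_differentiable_atlas:
  assumes "smooth_manifold M"
  shows "differentiable_atlas M"
  unfolding differentiable_atlas_def
proof (intro conjI ballI)
  show "(\<Union>c\<in>atlas M. fst c) = points M"
    using assms by (simp add: smooth_manifold_def)
next
  fix c assume c: "c \<in> atlas M"
  then have hom: "homeomorphic_map (subtopology (top_of M) (fst c)) (top_of_set (snd c ` fst c)) (snd c)"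
    and op: "openin (top_of M) (fst c)" and opi: "open (snd c ` fst c)"
    using assms by (auto simp: smooth_manifold_def)
  have top: "topspace (subtopology (top_of M) (fst c)) = fst c"
    using openin_subset[OF op] by (simp add: Int_absorb1)
  show "inj_on (snd c) (fst c)"
    using homeomorphic_imp_injective_map[OF hom] top by simp
  fix d assume d: "d \<in> atlas M"
  then have "openin (top_of M) (fst d)"
    using assms by (auto simp: smooth_manifold_def)
  then have "openin (subtopology (top_of M) (fst c)) (fst c \<inter> fst d)"
    by (auto simp: openin_subtopology)
  then have "openin (top_of_set (snd c ` fst c)) (snd c ` (fst c \<inter> fst d))"
    using homeomorphic_map_openness[OF hom, of "fst c \<inter> fst d"] top by blast
  then show "open (snd c ` (fst c \<inter> fst d))"
    using opi openin_open_trans by blast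
  fix p assume p: "p \<in> snd c ` (fst c \<inter> fst d)"
  have "smooth_on (snd c ` (fst c \<inter> fst d)) (transition c d)"
    using assms c d by (auto simp: smooth_manifold_def)
  then have "Ck_on (Suc 0) (snd c ` (fst c \<inter> fst d)) (transition c d)"
    unfolding smooth_on_def by blast
  then show "transition c d differentiable at p"
    using p by auto
qed

lemma charts_at_exists:
  "differentiable_atlas M \<Longrightarrow> x \<in> points M \<Longrightarrow> \<exists>c. c \<in> charts_at M x"
  unfolding differentiable_atlas_def charts_at_def by blast

lemma chart_chart_inv: "p \<in> snd c ` fst c \<Longrightarrow> snd c (chart_inv c p) = p"
  by (simp add: chart_inv_def f_inv_into_f)

lemma chart_inv_in: "p \<in> snd c ` fst c \<Longrightarrow> chart_inv c p \<in> fst c"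
  by (simp add: chart_inv_def inv_into_into)

lemma chart_inv_charts_at: "c \<in> atlas M \<Longrightarrow> p \<in> snd c ` fst c \<Longrightarrow> c \<in> charts_at M (chart_inv c p)"
  by (simp add: charts_at_def chart_inv_in)

context
  fixes M :: "('m, 'e::euclidean_space, 'z) manifold_scheme"
  assumes M: "differentiable_atlas M"
begin

lemma chart_inv_chart: "c \<in> charts_at M x \<Longrightarrow> chart_inv c (snd c x) = x"
  using M by (auto simp: charts_at_def chart_inv_def differentiable_atlas_def intro!: inv_into_f_f)

lemma chart_image_open: "c \<in> charts_at M x \<Longrightarrow> open (snd c ` fst c)"
  using M by (auto simp: differentiable_atlas_def charts_at_def) (metis inf.idem)

lemma overlap_image_open:
  "c \<in> charts_at M x \<Longrightarrow> d \<in> charts_at M x \<Longrightarrow> open (snd c ` (fst c \<inter> fst d))"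
  using M by (auto simp: differentiable_atlas_def charts_at_def)

lemma transition_has_derivative:
  "c \<in> charts_at M x \<Longrightarrow> d \<in> charts_at M x \<Longrightarrow>
    (transition c d has_derivative frechet_derivative (transition c d) (at (snd c x))) (at (snd c x))"
  using M by (auto simp: differentiable_atlas_def charts_at_def frechet_derivative_works[symmetric])

text \<open>
  The chain rule behind the independence of \<open>differential\<close> of the chart it chooses.
\<close>

lemma has_derivative_change_chart:
  assumes c: "c \<in> charts_at M x" and d: "d \<in> charts_at M x"
    and h: "((\<psi> \<circ> chart_inv d) has_derivative D) (at (snd d x))"
  shows "((\<psi> \<circ> chart_inv c) has_derivative
           D \<circ> frechet_derivative (transition c d) (at (snd c x))) (at (snd c x))"
proof (rule has_derivative_transform_within_open)
  have "transition c d (snd c x) = snd d x"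
    using chart_inv_chart[OF c] by (simp add: transition_def)
  then show "((\<psi> \<circ> chart_inv d \<circ> transition c d) has_derivative
           D \<circ> frechet_derivative (transition c d) (at (snd c x))) (at (snd c x))"
    using h by (intro diff_chain_at transition_has_derivative c d) simp
  show "open (snd c ` (fst c \<inter> fst d))" by (rule overlap_image_open[OF c d])
  show "snd c x \<in> snd c ` (fst c \<inter> fst d)" using c d by (auto simp: charts_at_def)
  fix p assume "p \<in> snd c ` (fst c \<inter> fst d)"
  then obtain y where y: "p = snd c y" "c \<in> charts_at M y" "d \<in> charts_at M y"
    using c d by (auto simp: charts_at_def)
  then show "(\<psi> \<circ> chart_inv d \<circ> transition c d) p = (\<psi> \<circ> chart_inv c) p"
    by (simp add: transition_def chart_inv_chart)
qed

lemma frechet_transition_self: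
  assumes c: "c \<in> charts_at M x"
  shows "frechet_derivative (transition c c) (at (snd c x)) = (\<lambda>a. a)"
proof -
  have "(transition c c has_derivative (\<lambda>a. a)) (at (snd c x))"
  proof (rule has_derivative_transform_within_open[OF has_derivative_ident])
    show "open (snd c ` fst c)" by (rule chart_image_open[OF c])
    show "snd c x \<in> snd c ` fst c" using c by (auto simp: charts_at_def)
  qed (simp add: transition_def chart_chart_inv)
  then show ?thesis by (rule frechet_derivative_at[symmetric])
qed

lemma frechet_transition_cocycle:
  assumes c: "c \<in> charts_at M x" and d: "d \<in> charts_at M x" and e: "e \<in> charts_at M x"
  shows "frechet_derivative (transition c e) (at (snd c x)) a =
     frechet_derivative (transition d e) (at (snd d x))
       (frechet_derivative (transition c d) (at (snd c x)) a)"
proof -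
  have "((snd e \<circ> chart_inv c) has_derivative
      frechet_derivative (transition d e) (at (snd d x)) \<circ>
      frechet_derivative (transition c d) (at (snd c x))) (at (snd c x))"
    by (rule has_derivative_change_chart[OF c d])
      (use transition_has_derivative[OF d e] in \<open>simp add: transition_def\<close>)
  from fun_cong[OF frechet_derivative_at[OF this], of a] show ?thesis
    by (simp add: transition_def)
qed

lemma coord_vec_tangent:
  assumes c: "c \<in> charts_at M x"
  shows "coord_vec M c x a \<in> tangent_space M x"
  unfolding tangent_space_def coord_vec_def
  by (auto intro!: frechet_transition_cocycle c)

lemma coord_vec_apply: "c \<in> charts_at M x \<Longrightarrow> coord_vec M c x a c = a"
  by (simp add: coord_vec_def frechet_transition_self)

lemma tangent_eq_coord_vec:
  assumes c: "c \<in> charts_at M x" and X: "X \<in> tangent_space M x"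
  shows "coord_vec M c x (X c) = X"
proof
  fix d
  show "coord_vec M c x (X c) d = X d"
  proof (cases "d \<in> charts_at M x")
    case True
    then have "X d = frechet_derivative (transition c d) (at (snd c x)) (X c)"
      using c X unfolding tangent_space_def by blast
    then show ?thesis using True by (simp add: coord_vec_def)
  next
    case False
    then have "X d = 0" using X unfolding tangent_space_def by blast
    then show ?thesis using False by (simp add: coord_vec_def)
  qed
qed

lemma coord_vec_linear:
  assumes c: "c \<in> charts_at M x"
  shows "linear (\<lambda>a. coord_vec M c x a d)"
proof (cases "d \<in> charts_at M x")
  case True
  have "linear (frechet_derivative (transition c d) (at (snd c x)))"
    using transition_has_derivative[OF c True] has_derivative_linear by blast
  then show ?thesis using True by (simp add: coord_vec_def)
next
  case False
  then show ?thesis by (simp add: coord_vec_def linear_zero)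
qed

text \<open>
  The differential, defined through an arbitrarily chosen chart, may be computed in any chart around the point.
\<close>

lemma differential_chart:
  assumes c: "c \<in> charts_at M x" and X: "X \<in> tangent_space M x"
    and d: "d \<in> charts_at N (\<psi> x)"
    and diff: "(snd d \<circ> \<psi> \<circ> chart_inv c) differentiable at (snd c x)"
  shows "differential M N \<psi> x X d =
    frechet_derivative (snd d \<circ> \<psi> \<circ> chart_inv c) (at (snd c x)) (X c)"
proof -
  define k where "k = (SOME c. c \<in> charts_at M x)"
  have k: "k \<in> charts_at M x" unfolding k_def using c by (rule someI)
  have "((snd d \<circ> \<psi> \<circ> chart_inv k) has_derivative
      frechet_derivative (snd d \<circ> \<psi> \<circ> chart_inv c) (at (snd c x)) \<circ>
      frechet_derivative (transition k c) (at (snd k x))) (at (snd k x))"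
    using diff unfolding frechet_derivative_works by (rule has_derivative_change_chart[OF k c])
  from fun_cong[OF frechet_derivative_at[OF this], of "X k"]
  have "differential M N \<psi> x X d = frechet_derivative (snd d \<circ> \<psi> \<circ> chart_inv c) (at (snd c x))
      (frechet_derivative (transition k c) (at (snd k x)) (X k))"
    using d unfolding differential_def Let_def k_def[symmetric] by simp
  moreover have "X c = frechet_derivative (transition k c) (at (snd k x)) (X k)"
    using X k c unfolding tangent_space_def by blast
  ultimately show ?thesis by simp
qed

lemma differential_euclidean_chart:
  fixes \<psi> :: "'m \<Rightarrow> 'b::euclidean_space"
  assumes c: "c \<in> charts_at M x" and X: "X \<in> tangent_space M x"
    and diff: "(\<psi> \<circ> chart_inv c) differentiable at (snd c x)"
  shows "differential M euclidean_riemannian \<psi> x X id_chart =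
    frechet_derivative (\<psi> \<circ> chart_inv c) (at (snd c x)) (X c)"
  using differential_chart[OF c X, where N = euclidean_riemannian and d = id_chart and \<psi> = \<psi>] diff
  by (simp add: charts_at_def euclidean_riemannian_def o_def)

end

section \<open>The metric, the gradient and the energy density in a chart\<close>

text \<open>
  The metric at \<open>x\<close> in the coordinates of the chart \<open>c\<close>, as a form on the model space.
\<close>

definition coord_metric ::
  "('m, 'e::euclidean_space) riemannian \<Rightarrow> ('m, 'e) chart \<Rightarrow> 'm \<Rightarrow> 'e \<Rightarrow> 'e \<Rightarrow> real" where
  "coord_metric M c x a b = metric M x (coord_vec M c x a) (coord_vec M c x b)"

lemma riemannian_differentiable_atlas: "riemannian_manifold M \<Longrightarrow> differentiable_atlas M"
  by (simp add: riemannian_manifold_def smooth_manifold_differentiable_atlas)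

lemma charts_at_points: "differentiable_atlas M \<Longrightarrow> c \<in> charts_at M x \<Longrightarrow> x \<in> points M"
  unfolding differentiable_atlas_def charts_at_def by blast

lemma riemannian_coord_metric_pos_def:
  assumes M: "riemannian_manifold M" and c: "c \<in> charts_at M x"
  shows "pos_def_form (coord_metric M c x)"
  unfolding pos_def_form_def
proof (intro conjI allI impI)
  note D = riemannian_differentiable_atlas[OF M]
  note T = coord_vec_tangent[OF D c]
  have x: "x \<in> points M" by (rule charts_at_points[OF D c])
  show sym: "coord_metric M c x a b = coord_metric M c x b a" for a b
    using M x T unfolding riemannian_manifold_def coord_metric_def by blast
  have lin: "coord_metric M c x (r *\<^sub>R a + s *\<^sub>R a') b
      = r * coord_metric M c x a b + s * coord_metric M c x a' b" for r s a a' b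
  proof -
    have "coord_vec M c x (r *\<^sub>R a + s *\<^sub>R a') =
        (\<lambda>d. r *\<^sub>R coord_vec M c x a d + s *\<^sub>R coord_vec M c x a' d)"
      using linear_add[OF coord_vec_linear[OF D c]] linear_scale[OF coord_vec_linear[OF D c]]
      by (intro ext) simp
    then show ?thesis
      using M x T unfolding riemannian_manifold_def coord_metric_def by simp
  qed
  show "linear (coord_metric M c x a)" for a
    using lin[of 1 _ 1 _ a] lin[of _ _ 0 0 a] by (intro linearI) (simp_all add: sym[of a])
  fix a :: 'b assume "a \<noteq> 0"
  then have "coord_vec M c x a \<noteq> (\<lambda>d. 0)"
    using coord_vec_apply[OF D c, of a] by auto
  then show "0 < coord_metric M c x a a"
    using M x T unfolding riemannian_manifold_def coord_metric_def by blast
qed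

context
  fixes M :: "('m, 'e::euclidean_space) riemannian" and c x
  assumes D: "differentiable_atlas M" and c: "c \<in> charts_at M x"
    and pd: "pos_def_form (coord_metric M c x)"
begin

lemma metric_eq_coord_metric:
  "X \<in> tangent_space M x \<Longrightarrow> Y \<in> tangent_space M x \<Longrightarrow> metric M x X Y = coord_metric M c x (X c) (Y c)"
  by (simp add: coord_metric_def tangent_eq_coord_vec[OF D c])

lemma tangent_eqI:
  "X \<in> tangent_space M x \<Longrightarrow> Y \<in> tangent_space M x \<Longrightarrow> X c = Y c \<Longrightarrow> X = Y"
  using tangent_eq_coord_vec[OF D c] by metis

lemma orthonormal_basis_frame:
  assumes B: "orthonormal_basis M x B"
  shows "inj_on (\<lambda>X. X c) B" and "orthonormal_frame (coord_metric M c x) ((\<lambda>X. X c) ` B)"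
proof -
  have fin: "finite B" and BT: "B \<subseteq> tangent_space M x"
    and on: "\<And>X Y. X \<in> B \<Longrightarrow> Y \<in> B \<Longrightarrow> metric M x X Y = (if X = Y then 1 else 0)"
    and sp: "\<And>X. X \<in> tangent_space M x \<Longrightarrow> \<exists>a. X = (\<lambda>c. \<Sum>E\<in>B. a E *\<^sub>R E c)"
    using B by (auto simp: orthonormal_basis_def)
  show inj: "inj_on (\<lambda>X. X c) B"
    using BT tangent_eqI by (auto intro!: inj_onI)
  have "a \<in> span ((\<lambda>X. X c) ` B)" for a
  proof -
    obtain k where "coord_vec M c x a = (\<lambda>c. \<Sum>E\<in>B. k E *\<^sub>R E c)"
      using sp[OF coord_vec_tangent[OF D c]] by blast
    then have "a = (\<Sum>E\<in>B. k E *\<^sub>R E c)"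
      using coord_vec_apply[OF D c, of a] by metis
    then show ?thesis
      by (simp only:) (intro span_sum span_scale span_base imageI)
  qed
  moreover have "coord_metric M c x (X c) (Y c) = (if X c = Y c then 1 else 0)"
    if "X \<in> B" "Y \<in> B" for X Y
  proof -
    have "X \<in> tangent_space M x" "Y \<in> tangent_space M x" using that BT by auto
    moreover have "X c = Y c \<longleftrightarrow> X = Y" using inj_onD[OF inj _ that] by blast
    ultimately show ?thesis
      using on[OF that] metric_eq_coord_metric[of X Y] by simp
  qed
  ultimately show "orthonormal_frame (coord_metric M c x) ((\<lambda>X. X c) ` B)"
    using fin unfolding orthonormal_frame_def by (intro conjI ballI) auto
qed

lemma orthonormal_basis_exists: "\<exists>B. orthonormal_basis M x B"
proof -
  obtain F where F: "orthonormal_frame (coord_metric M c x) F"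
    using orthonormal_frame_exists[OF pd] by blast
  have fin: "finite F"
    and on: "\<And>a b. a \<in> F \<Longrightarrow> b \<in> F \<Longrightarrow> coord_metric M c x a b = (if a = b then 1 else 0)"
    using F by (auto simp: orthonormal_frame_def)
  have ap: "coord_vec M c x a c = a" for a by (rule coord_vec_apply[OF D c])
  have inj: "inj_on (coord_vec M c x) F"
    by (rule inj_on_inverseI[of _ "\<lambda>X. X c"]) (rule ap)
  have "orthonormal_basis M x (coord_vec M c x ` F)"
    unfolding orthonormal_basis_def
  proof (intro conjI ballI)
    show "finite (coord_vec M c x ` F)" using fin by simp
    show "coord_vec M c x ` F \<subseteq> tangent_space M x" using coord_vec_tangent[OF D c] by blast
  next
    fix X Y assume "X \<in> coord_vec M c x ` F" "Y \<in> coord_vec M c x ` F"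
    then obtain a b where "a \<in> F" "b \<in> F" "X = coord_vec M c x a" "Y = coord_vec M c x b" by blast
    then show "metric M x X Y = (if X = Y then 1 else 0)"
      using on[of a b] inj by (auto simp: coord_metric_def inj_on_def)
  next
    fix X assume X: "X \<in> tangent_space M x"
    define r where "r f = coord_metric M c x (X c) f" for f
    have Xc: "X c = (\<Sum>f\<in>F. r f *\<^sub>R f)"
      unfolding r_def by (rule pos_def_form_frame_expansion[OF pd F])
    have "X d = (\<Sum>E\<in>coord_vec M c x ` F. r (E c) *\<^sub>R E d)" for d
    proof -
      have "X d = coord_vec M c x (\<Sum>f\<in>F. r f *\<^sub>R f) d"
        using tangent_eq_coord_vec[OF D c X] Xc by simp
      also have "\<dots> = (\<Sum>f\<in>F. r f *\<^sub>R coord_vec M c x f d)"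
        using linear_sum[OF coord_vec_linear[OF D c, of d], of "\<lambda>f. r f *\<^sub>R f" F]
          linear_scale[OF coord_vec_linear[OF D c, of d]] by simp
      also have "\<dots> = (\<Sum>E\<in>coord_vec M c x ` F. r (E c) *\<^sub>R E d)"
        by (simp add: sum.reindex[OF inj] ap)
      finally show ?thesis .
    qed
    then have "X = (\<lambda>d. \<Sum>E\<in>coord_vec M c x ` F. r (E c) *\<^sub>R E d)" by (rule ext)
    then show "\<exists>a. X = (\<lambda>d. \<Sum>E\<in>coord_vec M c x ` F. a E *\<^sub>R E d)"
      by (rule exI[of _ "\<lambda>E. r (E c)"])
  qed
  then show ?thesis by blast
qed

lemma norm_differential_sq_frame:
  fixes \<psi> :: "'m \<Rightarrow> 'b::euclidean_space"
  assumes diff: "(\<psi> \<circ> chart_inv c) differentiable at (snd c x)"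
  obtains F where "orthonormal_frame (coord_metric M c x) F"
    and "norm_differential_sq M euclidean_riemannian \<psi> x =
      (\<Sum>b\<in>F. (norm (frechet_derivative (\<psi> \<circ> chart_inv c) (at (snd c x)) b))\<^sup>2)"
proof -
  define B where "B = (SOME B. orthonormal_basis M x B)"
  have B: "orthonormal_basis M x B"
    unfolding B_def by (rule someI_ex[OF orthonormal_basis_exists])
  let ?L = "frechet_derivative (\<psi> \<circ> chart_inv c) (at (snd c x))"
  have "norm_differential_sq M euclidean_riemannian \<psi> x = (\<Sum>E\<in>B. ?L (E c) \<bullet> ?L (E c))"
    unfolding norm_differential_sq_def B_def[symmetric]
  proof (rule sum.cong[OF refl])
    fix E assume "E \<in> B"
    then have "E \<in> tangent_space M x" using B by (auto simp: orthonormal_basis_def)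
    then show "metric euclidean_riemannian (\<psi> x) (differential M euclidean_riemannian \<psi> x E)
        (differential M euclidean_riemannian \<psi> x E) = ?L (E c) \<bullet> ?L (E c)"
      using differential_euclidean_chart[OF D c _ diff, of E]
      by (simp add: euclidean_riemannian_def)
  qed
  also have "\<dots> = (\<Sum>b\<in>(\<lambda>X. X c) ` B. (norm (?L b))\<^sup>2)"
    by (simp add: sum.reindex[OF orthonormal_basis_frame(1)[OF B]] power2_norm_eq_inner)
  finally show thesis
    using that orthonormal_basis_frame(2)[OF B] by blast
qed

text \<open>
  The energy density is the squared length of the vector that represents the differential.
\<close>

lemma norm_differential_sq_real:
  fixes u :: "'m \<Rightarrow> real"
  assumes diff: "(u \<circ> chart_inv c) differentiable at (snd c x)"
    and g: "\<And>b. coord_metric M c x g b = frechet_derivative (u \<circ> chart_inv c) (at (snd c x)) b"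
  shows "norm_differential_sq M euclidean_riemannian u x = coord_metric M c x g g"
proof -
  obtain F where F: "orthonormal_frame (coord_metric M c x) F"
    and eq: "norm_differential_sq M euclidean_riemannian u x =
      (\<Sum>b\<in>F. (norm (frechet_derivative (u \<circ> chart_inv c) (at (snd c x)) b))\<^sup>2)"
    using norm_differential_sq_frame[OF diff] by blast
  show ?thesis
    unfolding eq pos_def_form_parseval[OF pd F, of g] by (simp add: g)
qed

lemma grad_eq_coord_vec:
  fixes f :: "'m \<Rightarrow> real"
  assumes diff: "(f \<circ> chart_inv c) differentiable at (snd c x)"
    and g: "\<And>b. coord_metric M c x g b = frechet_derivative (f \<circ> chart_inv c) (at (snd c x)) b"
  shows "grad M f x = coord_vec M c x g"
  unfolding grad_def
proof (rule the_equality, intro conjI ballI)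
  show T: "coord_vec M c x g \<in> tangent_space M x" by (rule coord_vec_tangent[OF D c])
  fix Y assume Y: "Y \<in> tangent_space M x"
  show "metric M x (coord_vec M c x g) Y = differential M euclidean_riemannian f x Y id_chart"
    by (simp add: differential_euclidean_chart[OF D c Y diff] metric_eq_coord_metric[OF T Y]
        coord_vec_apply[OF D c] g)
next
  fix X assume X: "X \<in> tangent_space M x \<and> (\<forall>Y\<in>tangent_space M x.
    metric M x X Y = differential M euclidean_riemannian f x Y id_chart)"
  have "coord_metric M c x (X c) b = coord_metric M c x g b" for b
  proof -
    have T: "coord_vec M c x b \<in> tangent_space M x" by (rule coord_vec_tangent[OF D c])
    have "coord_metric M c x (X c) b = metric M x X (coord_vec M c x b)"
      using X T by (simp add: metric_eq_coord_metric coord_vec_apply[OF D c])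
    then show ?thesis
      using X T differential_euclidean_chart[OF D c T diff] by (simp add: coord_vec_apply[OF D c] g)
  qed
  then have "X c = g" by (rule pos_def_form_eqI[OF pd])
  then show "X = coord_vec M c x g"
    using tangent_eq_coord_vec[OF D c, of X] X by simp
qed

end

lemma Ck_map_euclidean_chart:
  fixes \<psi> :: "'m \<Rightarrow> 'b::euclidean_space"
  assumes "Ck_map k M euclidean_riemannian \<psi>" "c \<in> atlas M"
  shows "Ck_on k (snd c ` fst c) (\<psi> \<circ> chart_inv c)"
  using assms unfolding Ck_map_def by (auto simp: euclidean_riemannian_def o_def)

lemma norm_differential_sq_differentiable:
  fixes u :: "'m \<Rightarrow> real"
  assumes M: "riemannian_manifold M" and u: "Ck_map 2 M euclidean_riemannian u"
    and c: "c \<in> charts_at M x"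
  shows "(norm_differential_sq M euclidean_riemannian u \<circ> chart_inv c) differentiable at (snd c x)"
proof -
  note D = riemannian_differentiable_atlas[OF M]
  have cM: "c \<in> atlas M" and xc: "x \<in> fst c" using c by (auto simp: charts_at_def)
  define S where "S = snd c ` fst c"
  have S: "open S" "snd c x \<in> S"
    unfolding S_def using chart_image_open[OF D c] xc by auto
  have C2: "Ck_on (Suc (Suc 0)) S (u \<circ> chart_inv c)"
    using Ck_map_euclidean_chart[OF u cM] by (simp add: S_def numeral_2_eq_2)
  have cat: "c \<in> charts_at M (chart_inv c p)" if "p \<in> S" for p
    using chart_inv_charts_at[OF cM] that by (simp add: S_def)
  have sn: "snd c (chart_inv c p) = p" if "p \<in> S" for p
    using chart_chart_inv[of _ c] that by (simp add: S_def)
  have pd: "pos_def_form (coord_metric M c (chart_inv c p))" if "p \<in> S" for p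
    by (rule riemannian_coord_metric_pos_def[OF M cat[OF that]])
  show ?thesis
  proof (rule dual_norm_differentiable[OF S])
    show "pos_def_form (coord_metric M c (chart_inv c p))" if "p \<in> S" for p
      by (rule pd[OF that])
    show "(\<lambda>p. coord_metric M c (chart_inv c p) a b) differentiable at (snd c x)" for a b
    proof -
      have "smooth_on S (\<lambda>p. coord_metric M c (chart_inv c p) a b)"
        using M cM unfolding riemannian_manifold_def S_def coord_metric_def Let_def by blast
      then have "Ck_on (Suc 0) S (\<lambda>p. coord_metric M c (chart_inv c p) a b)"
        unfolding smooth_on_def by blast
      then show ?thesis using S by simp
    qed
    show "(\<lambda>p. frechet_derivative (u \<circ> chart_inv c) (at p) a) differentiable at (snd c x)" for a
      using C2 S by simp
    fix p assume p: "p \<in> S"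
    have diff: "(u \<circ> chart_inv c) differentiable at p" using C2 p by simp
    then have "linear (frechet_derivative (u \<circ> chart_inv c) (at p))"
      by (rule linear_frechet_derivative)
    then obtain g where g: "\<forall>b. coord_metric M c (chart_inv c p) g b
        = frechet_derivative (u \<circ> chart_inv c) (at p) b"
      using pos_def_form_riesz[OF pd[OF p]] by blast
    then show "\<exists>X. (\<forall>b. coord_metric M c (chart_inv c p) X b
        = frechet_derivative (u \<circ> chart_inv c) (at p) b) \<and>
      (norm_differential_sq M euclidean_riemannian u \<circ> chart_inv c) p
        = coord_metric M c (chart_inv c p) X X"
      using norm_differential_sq_real[OF D cat[OF p] pd[OF p], of u g] diff sn[OF p] by auto
  qed
qed

text \<open>
  Infinity-harmonicity of a function in an arbitrary chart; \<open>g\<close> is the coordinate vector of the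
  gradient of \<open>|du|\<^sup>2\<close>.
\<close>

lemma infinity_harmonic_function_chart:
  assumes M: "riemannian_manifold M" and u: "infinity_harmonic_function M u"
    and c: "c \<in> charts_at M x"
    and g: "\<And>b. coord_metric M c x g b =
      frechet_derivative (norm_differential_sq M euclidean_riemannian u \<circ> chart_inv c) (at (snd c x)) b"
  shows "frechet_derivative (u \<circ> chart_inv c) (at (snd c x)) g = 0"
proof -
  note D = riemannian_differentiable_atlas[OF M]
  have C2: "Ck_map 2 M euclidean_riemannian u"
    and h: "\<And>x. x \<in> points M \<Longrightarrow> (\<lambda>d. (1/2) *\<^sub>R differential M euclidean_riemannian u x
        (grad M (norm_differential_sq M euclidean_riemannian u) x) d) = (\<lambda>d. 0)"
    using u by (auto simp: infinity_harmonic_function_def infinity_harmonic_map_def)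
  have gr: "grad M (norm_differential_sq M euclidean_riemannian u) x = coord_vec M c x g"
    by (rule grad_eq_coord_vec[OF D c riemannian_coord_metric_pos_def[OF M c]
          norm_differential_sq_differentiable[OF M C2 c] g])
  have cM: "c \<in> atlas M" and xc: "x \<in> fst c" using c by (auto simp: charts_at_def)
  have "(u \<circ> chart_inv c) differentiable at (snd c x)"
    using Ck_map_euclidean_chart[OF C2 cM] xc by (simp add: numeral_2_eq_2)
  then have "differential M euclidean_riemannian u x (coord_vec M c x g) id_chart
      = frechet_derivative (u \<circ> chart_inv c) (at (snd c x)) g"
    using differential_euclidean_chart[OF D c coord_vec_tangent[OF D c]]
    by (simp add: coord_vec_apply[OF D c])
  moreover have "differential M euclidean_riemannian u x (coord_vec M c x g) id_chart = 0"
    using fun_cong[OF h[OF charts_at_points[OF D c]], of id_chart] gr by simp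
  ultimately show ?thesis by simp
qed

section \<open>The product of two manifolds\<close>

text \<open>
  The product of two charts, as it occurs in the atlas of the product manifold.
\<close>

definition prod_chart :: "('m, 'e) chart \<Rightarrow> ('n, 'f) chart \<Rightarrow> ('m \<times> 'n, 'e \<times> 'f) chart" where
  "prod_chart c d = (fst c \<times> fst d, map_prod (snd c) (snd d))"

lemma atlas_prod_riemannian:
  "atlas (prod_riemannian M N) = {prod_chart c d |c d. c \<in> atlas M \<and> d \<in> atlas N}"
  by (simp add: prod_riemannian_def prod_manifold_def prod_chart_def Let_def)

lemma top_of_prod_riemannian: "top_of (prod_riemannian M N) = prod_topology (top_of M) (top_of N)"
  by (simp add: prod_riemannian_def prod_manifold_def Let_def)

lemma charts_at_prod_riemannian:
  fixes M :: "('m, 'e::euclidean_space) riemannian" and N :: "('n, 'f::euclidean_space) riemannian"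
  shows "charts_at (prod_riemannian M N) (x, y) =
    {prod_chart c d |c d. c \<in> charts_at M x \<and> d \<in> charts_at N y}"
proof -
  have "(x, y) \<in> fst (prod_chart c d) \<longleftrightarrow> x \<in> fst c \<and> y \<in> fst d"
    for c :: "('m, 'e) chart" and d :: "('n, 'f) chart"
    by (simp add: prod_chart_def)
  then show ?thesis
    unfolding charts_at_def atlas_prod_riemannian by blast
qed

lemma metric_prod_riemannian:
  "metric (prod_riemannian M N) p X Y =
    metric M (fst p) (differential (prod_manifold M N) M fst p X)
      (differential (prod_manifold M N) M fst p Y) +
    metric N (snd p) (differential (prod_manifold M N) N snd p X)
      (differential (prod_manifold M N) N snd p Y)"
  by (simp add: prod_riemannian_def Let_def)

lemma charts_at_prod_manifold: "charts_at (prod_manifold M N) p = charts_at (prod_riemannian M N) p"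
  by (simp add: charts_at_def prod_riemannian_def Let_def)

lemma has_derivative_map_prod:
  assumes "(f has_derivative f') (at a)" "(g has_derivative g') (at b)"
  shows "(map_prod f g has_derivative map_prod f' g') (at (a, b))"
proof -
  have "((f \<circ> fst) has_derivative (f' \<circ> fst)) (at (a, b))"
    by (rule diff_chain_at) (use assms in \<open>auto intro!: derivative_eq_intros\<close>)
  moreover have "((g \<circ> snd) has_derivative (g' \<circ> snd)) (at (a, b))"
    by (rule diff_chain_at) (use assms in \<open>auto intro!: derivative_eq_intros\<close>)
  ultimately have "((\<lambda>p. ((f \<circ> fst) p, (g \<circ> snd) p)) has_derivative
      (\<lambda>h. ((f' \<circ> fst) h, (g' \<circ> snd) h))) (at (a, b))"
    by (rule has_derivative_Pair)
  moreover have "map_prod f g = (\<lambda>p. ((f \<circ> fst) p, (g \<circ> snd) p))"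
    "map_prod f' g' = (\<lambda>h. ((f' \<circ> fst) h, (g' \<circ> snd) h))"
    by (auto simp: fun_eq_iff)
  ultimately show ?thesis by simp
qed

lemma prod_chart_overlap_image:
  "snd (prod_chart c d) ` (fst (prod_chart c d) \<inter> fst (prod_chart c' d')) =
    (snd c ` (fst c \<inter> fst c')) \<times> (snd d ` (fst d \<inter> fst d'))"
  unfolding prod_chart_def fst_conv snd_conv Times_Int_Times by (rule map_prod_surj_on) simp_all

lemma prod_chart_image: "snd (prod_chart c d) ` fst (prod_chart c d) = snd c ` fst c \<times> snd d ` fst d"
  using prod_chart_overlap_image[of c d c d] by simp

lemma chart_inv_prod_chart:
  assumes M: "differentiable_atlas M" and N: "differentiable_atlas N"
    and c: "c \<in> atlas M" and d: "d \<in> atlas N"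
    and p: "p \<in> snd c ` fst c \<times> snd d ` fst d"
  shows "chart_inv (prod_chart c d) p = map_prod (chart_inv c) (chart_inv d) p"
proof -
  have inj: "inj_on (snd c) (fst c)" "inj_on (snd d) (fst d)"
    using M N c d by (simp_all add: differentiable_atlas_def)
  show ?thesis
    unfolding chart_inv_def prod_chart_def fst_conv snd_conv
  proof (rule inv_into_f_eq)
    show "inj_on (map_prod (snd c) (snd d)) (fst c \<times> fst d)"
      using inj by (rule map_prod_inj_on)
  qed (use p in \<open>auto simp: inv_into_into f_inv_into_f\<close>)
qed

lemma differentiable_atlas_prod_riemannian:
  assumes M: "differentiable_atlas M" and N: "differentiable_atlas N"
  shows "differentiable_atlas (prod_riemannian M N)"
  unfolding differentiable_atlas_def atlas_prod_riemannian top_of_prod_riemannian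
proof (intro conjI ballI)
  have "(\<Union>c\<in>atlas M. fst c) = points M" "(\<Union>c\<in>atlas N. fst c) = points N"
    using M N by (simp_all add: differentiable_atlas_def)
  moreover have "(\<Union>e\<in>{prod_chart c d |c d. c \<in> atlas M \<and> d \<in> atlas N}. fst e) =
      (\<Union>c\<in>atlas M. fst c) \<times> (\<Union>c\<in>atlas N. fst c)"
  proof -
    have "(\<Union>e\<in>{prod_chart c d |c d. c \<in> atlas M \<and> d \<in> atlas N}. fst e) =
        (\<Union>c\<in>atlas M. \<Union>d\<in>atlas N. fst (prod_chart c d))" by blast
    also have "\<dots> = (\<Union>c\<in>atlas M. \<Union>d\<in>atlas N. fst c \<times> fst d)" by (simp add: prod_chart_def)
    also have "\<dots> = (\<Union>c\<in>atlas M. fst c) \<times> (\<Union>c\<in>atlas N. fst c)" by blast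
    finally show ?thesis .
  qed
  ultimately show "(\<Union>e\<in>{prod_chart c d |c d. c \<in> atlas M \<and> d \<in> atlas N}. fst e) =
      topspace (prod_topology (top_of M) (top_of N))"
    by simp
next
  fix e assume "e \<in> {prod_chart c d |c d. c \<in> atlas M \<and> d \<in> atlas N}"
  then obtain c d where e: "e = prod_chart c d" and c: "c \<in> atlas M" and d: "d \<in> atlas N" by blast
  have "inj_on (snd c) (fst c)" "inj_on (snd d) (fst d)"
    using M N c d by (simp_all add: differentiable_atlas_def)
  then show "inj_on (snd e) (fst e)"
    unfolding e prod_chart_def by (auto intro: map_prod_inj_on)
  fix e' assume "e' \<in> {prod_chart c d |c d. c \<in> atlas M \<and> d \<in> atlas N}"
  then obtain c' d' where e': "e' = prod_chart c' d'" and c': "c' \<in> atlas M" and d': "d' \<in> atlas N"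
    by blast
  let ?S = "snd c ` (fst c \<inter> fst c')" and ?T = "snd d ` (fst d \<inter> fst d')"
  have ST: "open ?S" "open ?T"
    using M N c d c' d' by (simp_all add: differentiable_atlas_def)
  have tc: "transition c c' differentiable at p" if "p \<in> ?S" for p
    using M c c' that unfolding differentiable_atlas_def by blast
  have td: "transition d d' differentiable at p" if "p \<in> ?T" for p
    using N d d' that unfolding differentiable_atlas_def by blast
  show op: "open (snd e ` (fst e \<inter> fst e'))"
    unfolding e e' prod_chart_overlap_image by (rule open_Times[OF ST])
  fix p assume p: "p \<in> snd e ` (fst e \<inter> fst e')"
  obtain a b where ab: "p = (a, b)" by (cases p)
  have a: "a \<in> ?S" and b: "b \<in> ?T"
    using p unfolding e e' prod_chart_overlap_image ab by auto
  have "(map_prod (transition c c') (transition d d') has_derivative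
      map_prod (frechet_derivative (transition c c') (at a))
        (frechet_derivative (transition d d') (at b))) (at p)"
    unfolding ab using tc[OF a] td[OF b] unfolding frechet_derivative_works
    by (rule has_derivative_map_prod)
  then have "(transition e e' has_derivative
      map_prod (frechet_derivative (transition c c') (at a))
        (frechet_derivative (transition d d') (at b))) (at p)"
  proof (rule has_derivative_transform_within_open[OF _ op p])
    fix q assume q: "q \<in> snd e ` (fst e \<inter> fst e')"
    then have "q \<in> snd c ` fst c \<times> snd d ` fst d"
      unfolding e e' prod_chart_overlap_image by auto
    from chart_inv_prod_chart[OF M N c d this]
    show "map_prod (transition c c') (transition d d') q = transition e e' q"
      by (cases q) (simp add: transition_def e e', simp add: prod_chart_def)
  qed
  then show "transition e e' differentiable at p"
    unfolding differentiable_def by blast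
qed

text \<open>
  The product metric is an orthogonal sum in a suitable product chart around each point.  The
  chart is the one chosen by \<open>differential\<close> in the definition of the product metric; this
  choice makes the differentials of the two projections computable by unfolding alone.
\<close>

lemma coord_metric_prod_riemannian:
  assumes M: "differentiable_atlas M" and N: "differentiable_atlas N"
    and x: "x \<in> points M" and y: "y \<in> points N"
  obtains c d where "c \<in> charts_at M x" "d \<in> charts_at N y"
    "\<And>a b. coord_metric (prod_riemannian M N) (prod_chart c d) (x, y) a b =
      coord_metric M c x (fst a) (fst b) + coord_metric N d y (snd a) (snd b)"
proof -
  define e where "e = (SOME e. e \<in> charts_at (prod_riemannian M N) (x, y))"
  have "\<exists>e. e \<in> charts_at (prod_riemannian M N) (x, y)"
    using charts_at_exists[OF M x] charts_at_exists[OF N y]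
    unfolding charts_at_prod_riemannian by blast
  then have e: "e \<in> charts_at (prod_riemannian M N) (x, y)"
    unfolding e_def by (rule someI_ex)
  then obtain c d where ecd: "e = prod_chart c d" and c: "c \<in> charts_at M x" and d: "d \<in> charts_at N y"
    unfolding charts_at_prod_riemannian by blast
  have cM: "c \<in> atlas M" and dN: "d \<in> atlas N" using c d by (auto simp: charts_at_def)
  let ?S = "snd c ` fst c \<times> snd d ` fst d"
  have op: "open ?S"
    by (intro open_Times chart_image_open[OF M c] chart_image_open[OF N d])
  have sp: "snd e (x, y) = (snd c x, snd d y)" by (simp add: ecd prod_chart_def)
  have xy: "(snd c x, snd d y) \<in> ?S" using c d by (auto simp: charts_at_def)
  note inv = chart_inv_prod_chart[OF M N cM dN, folded ecd]
  have fst_diff: "differential (prod_manifold M N) M fst (x, y) Z = coord_vec M c x (fst (Z e))" for Z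
  proof
    fix k
    have "frechet_derivative (snd k \<circ> fst \<circ> chart_inv e) (at (snd c x, snd d y)) h =
        frechet_derivative (transition c k) (at (snd c x)) (fst h)" if k: "k \<in> charts_at M x" for h
    proof -
      have "((transition c k \<circ> fst) has_derivative
          (frechet_derivative (transition c k) (at (snd c x)) \<circ> fst)) (at (snd c x, snd d y))"
        by (rule diff_chain_at)
          (use transition_has_derivative[OF M c k] in \<open>auto intro!: derivative_eq_intros\<close>)
      then have "((snd k \<circ> fst \<circ> chart_inv e) has_derivative
          (frechet_derivative (transition c k) (at (snd c x)) \<circ> fst)) (at (snd c x, snd d y))"
        by (rule has_derivative_transform_within_open[OF _ op xy])
          (simp add: transition_def inv)
      from fun_cong[OF frechet_derivative_at[OF this], of h] show ?thesis by simp
    qed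
    then show "differential (prod_manifold M N) M fst (x, y) Z k = coord_vec M c x (fst (Z e)) k"
      unfolding differential_def Let_def charts_at_prod_manifold e_def[symmetric] coord_vec_def sp
      by simp
  qed
  have snd_diff: "differential (prod_manifold M N) N snd (x, y) Z = coord_vec N d y (snd (Z e))" for Z
  proof
    fix k
    have "frechet_derivative (snd k \<circ> snd \<circ> chart_inv e) (at (snd c x, snd d y)) h =
        frechet_derivative (transition d k) (at (snd d y)) (snd h)" if k: "k \<in> charts_at N y" for h
    proof -
      have "((transition d k \<circ> snd) has_derivative
          (frechet_derivative (transition d k) (at (snd d y)) \<circ> snd)) (at (snd c x, snd d y))"
        by (rule diff_chain_at)
          (use transition_has_derivative[OF N d k] in \<open>auto intro!: derivative_eq_intros\<close>)
      then have "((snd k \<circ> snd \<circ> chart_inv e) has_derivative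
          (frechet_derivative (transition d k) (at (snd d y)) \<circ> snd)) (at (snd c x, snd d y))"
        by (rule has_derivative_transform_within_open[OF _ op xy])
          (simp add: transition_def inv)
      from fun_cong[OF frechet_derivative_at[OF this], of h] show ?thesis by simp
    qed
    then show "differential (prod_manifold M N) N snd (x, y) Z k = coord_vec N d y (snd (Z e)) k"
      unfolding differential_def Let_def charts_at_prod_manifold e_def[symmetric] coord_vec_def sp
      by simp
  qed
  have "coord_metric (prod_riemannian M N) (prod_chart c d) (x, y) a b =
      coord_metric M c x (fst a) (fst b) + coord_metric N d y (snd a) (snd b)" for a b
  proof -
    have "coord_vec (prod_riemannian M N) e (x, y) h e = h" for h
      by (rule coord_vec_apply[OF differentiable_atlas_prod_riemannian[OF M N] e])
    then show ?thesis
      by (simp add: coord_metric_def ecd[symmetric] metric_prod_riemannian fst_diff snd_diff)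
  qed
  then show thesis using that c d by blast
qed

section \<open>Products of maps of class \<open>C\<^sup>k\<close>\<close>

lemma Ck_on_cong:
  "open S \<Longrightarrow> (\<And>p. p \<in> S \<Longrightarrow> f p = g p) \<Longrightarrow> Ck_on k S f \<Longrightarrow> Ck_on k S g"
proof (induction k arbitrary: f g)
  case 0
  then show ?case using continuous_on_cong[of S S f g] by simp
next
  case (Suc k)
  have eq: "frechet_derivative f (at p) v = frechet_derivative g (at p) v"
    and dg: "g differentiable at p" if p: "p \<in> S" for p v
  proof -
    have "(f has_derivative frechet_derivative f (at p)) (at p)"
      using Suc.prems(3) p by (simp add: frechet_derivative_works[symmetric])
    then have "(g has_derivative frechet_derivative f (at p)) (at p)"
      by (rule has_derivative_transform_within_open[OF _ Suc.prems(1) p]) (rule Suc.prems(2))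
    then show "frechet_derivative f (at p) v = frechet_derivative g (at p) v"
      "g differentiable at p"
      using frechet_derivative_at unfolding differentiable_def by (metis, blast)
  qed
  show ?case
    using Suc.IH[OF Suc.prems(1) eq] Suc.prems(3) dg by simp
qed

lemma Ck_on_map_prod:
  "open S \<Longrightarrow> open T \<Longrightarrow> Ck_on k S f \<Longrightarrow> Ck_on k T g \<Longrightarrow> Ck_on k (S \<times> T) (map_prod f g)"
proof (induction k arbitrary: f g)
  case 0
  have "continuous_on (S \<times> T) (\<lambda>p. f (fst p))"
    by (rule continuous_on_compose2[of S f]) (use 0 in \<open>auto intro: continuous_intros\<close>)
  moreover have "continuous_on (S \<times> T) (\<lambda>p. g (snd p))"
    by (rule continuous_on_compose2[of T g]) (use 0 in \<open>auto intro: continuous_intros\<close>)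
  ultimately show ?case
    by (simp add: map_prod_def case_prod_beta continuous_on_Pair)
next
  case (Suc k)
  have D: "(map_prod f g has_derivative
      map_prod (frechet_derivative f (at (fst p))) (frechet_derivative g (at (snd p)))) (at p)"
    if p: "p \<in> S \<times> T" for p
  proof -
    have "(f has_derivative frechet_derivative f (at (fst p))) (at (fst p))"
      "(g has_derivative frechet_derivative g (at (snd p))) (at (snd p))"
      using Suc.prems(3,4) p by (auto simp: frechet_derivative_works[symmetric])
    from has_derivative_map_prod[OF this] show ?thesis by simp
  qed
  have "Ck_on k (S \<times> T) (\<lambda>p. frechet_derivative (map_prod f g) (at p) v)" for v
  proof (rule Ck_on_cong)
    show "open (S \<times> T)" using Suc.prems by (intro open_Times)
    show "Ck_on k (S \<times> T) (map_prod (\<lambda>p. frechet_derivative f (at p) (fst v))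
        (\<lambda>p. frechet_derivative g (at p) (snd v)))"
      using Suc.prems by (intro Suc.IH) auto
    fix p assume "p \<in> S \<times> T"
    from fun_cong[OF frechet_derivative_at[OF D[OF this]], of v]
    show "map_prod (\<lambda>p. frechet_derivative f (at p) (fst v))
        (\<lambda>p. frechet_derivative g (at p) (snd v)) p = frechet_derivative (map_prod f g) (at p) v"
      by (cases p, cases v) simp
  qed
  then show ?case using D unfolding Ck_on.simps differentiable_def by blast
qed

lemma Ck_map_prod_riemannian:
  fixes u :: "'m \<Rightarrow> 'a::euclidean_space" and v :: "'n \<Rightarrow> 'b::euclidean_space"
    and M :: "('m, 'e::euclidean_space) riemannian" and N :: "('n, 'f::euclidean_space) riemannian"
  assumes M: "differentiable_atlas M" and N: "differentiable_atlas N"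
    and u: "Ck_map k M euclidean_riemannian u" and v: "Ck_map k N euclidean_riemannian v"
  shows "Ck_map k (prod_riemannian M N) euclidean_riemannian (map_prod u v)"
  unfolding Ck_map_def
proof (intro conjI ballI)
  have "continuous_map (top_of M) euclidean u" "continuous_map (top_of N) euclidean v"
    using u v by (auto simp: Ck_map_def euclidean_riemannian_def)
  then have "continuous_map (prod_topology (top_of M) (top_of N)) (prod_topology euclidean euclidean)
      (\<lambda>(x, y). (u x, v y))"
    by (simp only: continuous_map_prod_top) blast
  then show "continuous_map (top_of (prod_riemannian M N)) (top_of euclidean_riemannian) (map_prod u v)"
    by (simp add: top_of_prod_riemannian euclidean_riemannian_def map_prod_def)
next
  fix e and k' :: "('a \<times> 'b, 'a \<times> 'b) chart"
  assume "e \<in> atlas (prod_riemannian M N)" and "k' \<in> atlas euclidean_riemannian"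
  then obtain c d where e: "e = prod_chart c d" and c: "c \<in> atlas M" and d: "d \<in> atlas N"
    and k': "k' = id_chart"
    unfolding atlas_prod_riemannian by (auto simp: euclidean_riemannian_def)
  let ?S = "snd c ` fst c" and ?T = "snd d ` fst d"
  have ST: "open ?S" "open ?T"
    using M N c d unfolding differentiable_atlas_def by (metis inf.idem)+
  have "Ck_on k (?S \<times> ?T) (map_prod (u \<circ> chart_inv c) (v \<circ> chart_inv d))"
    by (rule Ck_on_map_prod[OF ST Ck_map_euclidean_chart[OF u c] Ck_map_euclidean_chart[OF v d]])
  then have "Ck_on k (?S \<times> ?T) (map_prod u v \<circ> chart_inv e)"
    by (rule Ck_on_cong[OF open_Times[OF ST], rotated])
      (auto simp: e chart_inv_prod_chart[OF M N c d])
  then show "Ck_on k (snd e ` (fst e \<inter> map_prod u v -` fst k')) (snd k' \<circ> map_prod u v \<circ> chart_inv e)"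
    by (simp add: k' e prod_chart_image o_def)
qed

section \<open>Pairs of infinity-harmonic functions\<close>

theorem proposition4p4:
  fixes M :: "('m, 'e::euclidean_space) riemannian"
    and N :: "('n, 'f::euclidean_space) riemannian"
    and u :: "'m \<Rightarrow> real" and v :: "'n \<Rightarrow> real"
  assumes "riemannian_manifold M" and "riemannian_manifold N"
    and "infinity_harmonic_function M u" and "infinity_harmonic_function N v"
  shows "infinity_harmonic_map (prod_riemannian M N)
           (euclidean_riemannian :: (real \<times> real, real \<times> real) riemannian)
           (\<lambda>(x, y). (u x, v y))"
proof -
  let ?E = "euclidean_riemannian :: (real, real) riemannian"
  let ?E2 = "euclidean_riemannian :: (real \<times> real, real \<times> real) riemannian"
  let ?P = "prod_riemannian M N"
  note M = assms(1) and N = assms(2)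
  note DM = riemannian_differentiable_atlas[OF M] and DN = riemannian_differentiable_atlas[OF N]
  note DP = differentiable_atlas_prod_riemannian[OF DM DN]
  have u: "Ck_map 2 M ?E u" and v: "Ck_map 2 N ?E v"
    using assms(3,4) by (auto simp: infinity_harmonic_function_def infinity_harmonic_map_def)
  define \<phi> where "\<phi> = map_prod u v"
  define w where "w = norm_differential_sq ?P ?E2 \<phi>"
  define nu where "nu = norm_differential_sq M ?E u"
  define nv where "nv = norm_differential_sq N ?E v"
  have C2: "Ck_map 2 ?P ?E2 \<phi>"
    unfolding \<phi>_def by (rule Ck_map_prod_riemannian[OF DM DN u v])
  have du: "(u \<circ> chart_inv c) differentiable at (snd c x)" if "c \<in> charts_at M x" for c x
    using Ck_map_euclidean_chart[OF u, of c] that by (auto simp: numeral_2_eq_2 charts_at_def)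
  have dv: "(v \<circ> chart_inv c) differentiable at (snd c x)" if "c \<in> charts_at N x" for c x
    using Ck_map_euclidean_chart[OF v, of c] that by (auto simp: numeral_2_eq_2 charts_at_def)
  have d\<phi>: "((\<phi> \<circ> chart_inv (prod_chart c d)) has_derivative
      map_prod (frechet_derivative (u \<circ> chart_inv c) (at (snd c x)))
        (frechet_derivative (v \<circ> chart_inv d) (at (snd d y)))) (at (snd c x, snd d y))"
    if c: "c \<in> charts_at M x" and d: "d \<in> charts_at N y" for c d x y
  proof (rule has_derivative_transform_within_open)
    show "(map_prod (u \<circ> chart_inv c) (v \<circ> chart_inv d) has_derivative
      map_prod (frechet_derivative (u \<circ> chart_inv c) (at (snd c x)))
        (frechet_derivative (v \<circ> chart_inv d) (at (snd d y)))) (at (snd c x, snd d y))"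
      using du[OF c] dv[OF d] unfolding frechet_derivative_works by (rule has_derivative_map_prod)
    show "open (snd c ` fst c \<times> snd d ` fst d)"
      by (intro open_Times chart_image_open[OF DM c] chart_image_open[OF DN d])
    show "(snd c x, snd d y) \<in> snd c ` fst c \<times> snd d ` fst d"
      using c d by (auto simp: charts_at_def)
    show "map_prod (u \<circ> chart_inv c) (v \<circ> chart_inv d) p = (\<phi> \<circ> chart_inv (prod_chart c d)) p"
      if "p \<in> snd c ` fst c \<times> snd d ` fst d" for p
      using chart_inv_prod_chart[OF DM DN _ _ that] c d
      by (cases p) (simp add: \<phi>_def charts_at_def)
  qed
  have w: "w (x, y) = nu x + nv y" if x: "x \<in> points M" and y: "y \<in> points N" for x y
  proof -
    obtain c d where c: "c \<in> charts_at M x" and d: "d \<in> charts_at N y"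
      and g: "\<And>a b. coord_metric ?P (prod_chart c d) (x, y) a b =
        coord_metric M c x (fst a) (fst b) + coord_metric N d y (snd a) (snd b)"
      using coord_metric_prod_riemannian[OF DM DN x y] by blast
    note pM = riemannian_coord_metric_pos_def[OF M c] and pN = riemannian_coord_metric_pos_def[OF N d]
    let ?e = "prod_chart c d"
    let ?U = "frechet_derivative (u \<circ> chart_inv c) (at (snd c x))"
    let ?V = "frechet_derivative (v \<circ> chart_inv d) (at (snd d y))"
    have e: "?e \<in> charts_at ?P (x, y)" using c d unfolding charts_at_prod_riemannian by blast
    have se: "snd ?e (x, y) = (snd c x, snd d y)" by (simp add: prod_chart_def)
    have pP: "pos_def_form (coord_metric ?P ?e (x, y))"
      using pos_def_form_prod[OF pM pN] by (simp add: g[abs_def])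
    obtain a where a: "\<And>h. coord_metric M c x a h = ?U h"
      using pos_def_form_riesz[OF pM linear_frechet_derivative[OF du[OF c]]] by blast
    obtain b where b: "\<And>h. coord_metric N d y b h = ?V h"
      using pos_def_form_riesz[OF pN linear_frechet_derivative[OF dv[OF d]]] by blast
    have diff: "(\<phi> \<circ> chart_inv ?e) differentiable at (snd ?e (x, y))"
      using d\<phi>[OF c d] unfolding se differentiable_def by blast
    obtain F where F: "orthonormal_frame (coord_metric ?P ?e (x, y)) F"
      and wF: "w (x, y) = (\<Sum>h\<in>F. (norm (frechet_derivative (\<phi> \<circ> chart_inv ?e) (at (snd ?e (x, y))) h))\<^sup>2)"
      using norm_differential_sq_frame[OF DP e pP diff] unfolding w_def by blast
    \<comment> \<open>The components of \<open>d\<phi>\<close> are represented by \<open>(a, 0)\<close> and \<open>(0, b)\<close>.\<close>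
    have "w (x, y) = (\<Sum>h\<in>F. (coord_metric ?P ?e (x, y) (a, 0) h)\<^sup>2) +
        (\<Sum>h\<in>F. (coord_metric ?P ?e (x, y) (0, b) h)\<^sup>2)"
      unfolding wF sum.distrib[symmetric]
    proof (rule sum.cong[OF refl])
      fix h
      have "frechet_derivative (\<phi> \<circ> chart_inv ?e) (at (snd ?e (x, y))) h = (?U (fst h), ?V (snd h))"
        using fun_cong[OF frechet_derivative_at[OF d\<phi>[OF c d]], of h] unfolding se
        by (cases h) simp
      then show "(norm (frechet_derivative (\<phi> \<circ> chart_inv ?e) (at (snd ?e (x, y))) h))\<^sup>2 =
          (coord_metric ?P ?e (x, y) (a, 0) h)\<^sup>2 + (coord_metric ?P ?e (x, y) (0, b) h)\<^sup>2"
        by (simp add: g a b norm_Pair pos_def_form_zero[OF pM] pos_def_form_zero[OF pN])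
    qed
    also have "\<dots> = coord_metric M c x a a + coord_metric N d y b b"
      unfolding pos_def_form_parseval[OF pP F, symmetric]
      by (simp add: g pos_def_form_zero[OF pM] pos_def_form_zero[OF pN])
    also have "coord_metric M c x a a = nu x"
      unfolding nu_def by (rule norm_differential_sq_real[OF DM c pM du[OF c] a, symmetric])
    also have "coord_metric N d y b b = nv y"
      unfolding nv_def by (rule norm_differential_sq_real[OF DN d pN dv[OF d] b, symmetric])
    finally show ?thesis .
  qed
  have "differential ?P ?E2 \<phi> (x, y) (grad ?P w (x, y)) = (\<lambda>k. 0)"
    if x: "x \<in> points M" and y: "y \<in> points N" for x y
  proof -
    obtain c d where c: "c \<in> charts_at M x" and d: "d \<in> charts_at N y"
      and g: "\<And>a b. coord_metric ?P (prod_chart c d) (x, y) a b =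
        coord_metric M c x (fst a) (fst b) + coord_metric N d y (snd a) (snd b)"
      using coord_metric_prod_riemannian[OF DM DN x y] by blast
    note pM = riemannian_coord_metric_pos_def[OF M c] and pN = riemannian_coord_metric_pos_def[OF N d]
    have cM: "c \<in> atlas M" and dN: "d \<in> atlas N" using c d by (auto simp: charts_at_def)
    let ?e = "prod_chart c d"
    have e: "?e \<in> charts_at ?P (x, y)" using c d unfolding charts_at_prod_riemannian by blast
    have se: "snd ?e (x, y) = (snd c x, snd d y)" by (simp add: prod_chart_def)
    have pP: "pos_def_form (coord_metric ?P ?e (x, y))"
      using pos_def_form_prod[OF pM pN] by (simp add: g[abs_def])
    let ?A = "frechet_derivative (nu \<circ> chart_inv c) (at (snd c x))"
    let ?B = "frechet_derivative (nv \<circ> chart_inv d) (at (snd d y))"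
    have dnu: "(nu \<circ> chart_inv c) differentiable at (snd c x)"
      unfolding nu_def by (rule norm_differential_sq_differentiable[OF M u c])
    have dnv: "(nv \<circ> chart_inv d) differentiable at (snd d y)"
      unfolding nv_def by (rule norm_differential_sq_differentiable[OF N v d])
    obtain a where a: "\<And>h. coord_metric M c x a h = ?A h"
      using pos_def_form_riesz[OF pM linear_frechet_derivative[OF dnu]] by blast
    obtain b where b: "\<And>h. coord_metric N d y b h = ?B h"
      using pos_def_form_riesz[OF pN linear_frechet_derivative[OF dnv]] by blast
    have dw: "((w \<circ> chart_inv ?e) has_derivative (\<lambda>h. ?A (fst h) + ?B (snd h))) (at (snd ?e (x, y)))"
    proof (rule has_derivative_transform_within_open)
      have "(map_prod (nu \<circ> chart_inv c) (nv \<circ> chart_inv d) has_derivative map_prod ?A ?B)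
          (at (snd c x, snd d y))"
        using dnu dnv unfolding frechet_derivative_works by (rule has_derivative_map_prod)
      from has_derivative_add[OF has_derivative_fst[OF this] has_derivative_snd[OF this]]
      show "((\<lambda>p. (nu \<circ> chart_inv c) (fst p) + (nv \<circ> chart_inv d) (snd p)) has_derivative
          (\<lambda>h. ?A (fst h) + ?B (snd h))) (at (snd ?e (x, y)))"
        by (simp add: se)
      show "open (snd c ` fst c \<times> snd d ` fst d)"
        by (intro open_Times chart_image_open[OF DM c] chart_image_open[OF DN d])
      show "snd ?e (x, y) \<in> snd c ` fst c \<times> snd d ` fst d"
        using c d by (auto simp: charts_at_def se)
      fix p assume p: "p \<in> snd c ` fst c \<times> snd d ` fst d"
      then have "chart_inv c (fst p) \<in> points M" "chart_inv d (snd p) \<in> points N"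
        using charts_at_points[OF DM chart_inv_charts_at[OF cM]]
          charts_at_points[OF DN chart_inv_charts_at[OF dN]] by auto
      then show "(nu \<circ> chart_inv c) (fst p) + (nv \<circ> chart_inv d) (snd p) = (w \<circ> chart_inv ?e) p"
        using chart_inv_prod_chart[OF DM DN cM dN p] w by (cases p) simp
    qed
    have grad: "grad ?P w (x, y) = coord_vec ?P ?e (x, y) (a, b)"
    proof (rule grad_eq_coord_vec[OF DP e pP])
      show "(w \<circ> chart_inv ?e) differentiable at (snd ?e (x, y))"
        using dw unfolding differentiable_def by blast
      show "coord_metric ?P ?e (x, y) (a, b) h =
          frechet_derivative (w \<circ> chart_inv ?e) (at (snd ?e (x, y))) h" for h
        using fun_cong[OF frechet_derivative_at[OF dw], of h] by (simp add: g a b)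
    qed
    have u0: "frechet_derivative (u \<circ> chart_inv c) (at (snd c x)) a = 0"
      by (rule infinity_harmonic_function_chart[OF M assms(3) c]) (use a in \<open>simp add: nu_def\<close>)
    have v0: "frechet_derivative (v \<circ> chart_inv d) (at (snd d y)) b = 0"
      by (rule infinity_harmonic_function_chart[OF N assms(4) d]) (use b in \<open>simp add: nv_def\<close>)
    have "(\<phi> \<circ> chart_inv ?e) differentiable at (snd ?e (x, y))"
      using d\<phi>[OF c d] unfolding se differentiable_def by blast
    from differential_euclidean_chart[OF DP e coord_vec_tangent[OF DP e] this, of "(a, b)"]
    have "differential ?P ?E2 \<phi> (x, y) (grad ?P w (x, y)) id_chart =
        frechet_derivative (\<phi> \<circ> chart_inv ?e) (at (snd ?e (x, y))) (a, b)"
      by (simp add: grad coord_vec_apply[OF DP e])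
    also have "\<dots> = 0"
      using fun_cong[OF frechet_derivative_at[OF d\<phi>[OF c d]], of "(a, b)"]
      by (simp add: se u0 v0 zero_prod_def)
    finally have "differential ?P ?E2 \<phi> (x, y) (grad ?P w (x, y)) id_chart = 0" .
    moreover have "differential ?P ?E2 \<phi> (x, y) X k = 0" if "k \<noteq> id_chart" for X k
      using that by (simp add: differential_def Let_def charts_at_def euclidean_riemannian_def)
    ultimately have "differential ?P ?E2 \<phi> (x, y) (grad ?P w (x, y)) k = 0" for k
      by (cases "k = id_chart") blast+
    then show ?thesis by (rule ext)
  qed
  then have "infinity_harmonic_map ?P ?E2 \<phi>"
    unfolding infinity_harmonic_map_def w_def[symmetric]
    using C2 by (auto simp: top_of_prod_riemannian)
  then show ?thesis
    unfolding \<phi>_def map_prod_def .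
qed

end
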